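(* Let $\Omega\subset\mathbb{R}^3$ be an open connected set with Lipschitz boundary (not necessarily bounded), and let $\boldsymbol{M}:\Omega\to\mathbb{R}^3$ be a vector field with $\int_\Omega |\boldsymbol{M}|^2\,dx<\infty$. Then the variational problem: find $u\in W^1_0(\mathbb{R}^3)$ such that $$\forall v\in W^1_0(\mathbb{R}^3),\quad \int_{\mathbb{R}^3}\nabla u\cdot\nabla v\,dx=\int_\Omega \boldsymbol{M}\cdot\nabla v\,dx,$$ and consequently the equation $\Delta u=\operatorname{div}(\boldsymbol{M}\chi_\Omega)$ in $\mathbb{R}^3$ (in the sense of distributions), has one and only one solution $u$ in $W^1_0(\mathbb{R}^3)$. Moreover, $$\|(|\boldsymbol{x}|^2+1)^{-1/2}u\|_{L^2(\mathbb{R}^3)}\leq 2\,\|\boldsymbol{M}\|_{L^2(\Omega)},\qquad \|\nabla u\|_{L^2(\mathbb{R}^3)^3}\leq \|\boldsymbol{M}\|_{L^2(\Omega)}.$$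
   Context: $W^1_0(\mathbb{R}^3)$ denotes the weighted space of all functions (distributions) $v$ on $\mathbb{R}^3$ such that $(1+|\boldsymbol{x}|^2)^{-1/2}v\in L^2(\mathbb{R}^3)$ and $\nabla v\in L^2(\mathbb{R}^3)^3$, with norm $\|v\|_{W^1_0(\mathbb{R}^3)}=\left(\int_{\mathbb{R}^3}\frac{|v|^2}{|\boldsymbol{x}|^2+1}dx+\int_{\mathbb{R}^3}|\nabla v|^2dx\right)^{1/2}$. (The subscript $0$ refers to the weight, not to a boundary condition.) $\chi_\Omega$ is the indicator function of $\Omega$, and $\boldsymbol{M}\chi_\Omega$ is the extension of $\boldsymbol{M}$ by zero to $\mathbb{R}^3$. $\|\boldsymbol{M}\|_{L^2(\Omega)}=\left(\int_\Omega|\boldsymbol{M}|^2dx\right)^{1/2}$. *)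

theory Defs
  imports "HOL-Analysis.Analysis"
begin

text \<open>Near each boundary point the set is the strict epigraph of a Lipschitz function of the
  orthogonal projection onto the hyperplane normal to some unit vector \<open>e\<close>, i.e. of the remaining
  coordinates in an orthonormal frame with last vector \<open>e\<close>. The charts are local: no uniformity
  in the boundary point is required, and the set may be unbounded.\<close>

definition lipschitz_boundary :: "'a::euclidean_space set \<Rightarrow> bool" where
  "lipschitz_boundary \<Omega> \<longleftrightarrow>
    (\<forall>x0\<in>frontier \<Omega>. \<exists>U e \<gamma> L. open U \<and> x0 \<in> U \<and> norm e = 1 \<and>
       L-lipschitz_on {y. y \<bullet> e = 0} (\<gamma> :: 'a \<Rightarrow> real) \<and>
       \<Omega> \<inter> U = {x\<in>U. \<gamma> (x - (x \<bullet> e) *\<^sub>R e) < x \<bullet> e})"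

definition L2_on :: "'a::euclidean_space set \<Rightarrow> ('a \<Rightarrow> 'b::euclidean_space) \<Rightarrow> bool" where
  "L2_on S f \<longleftrightarrow> f \<in> borel_measurable (lebesgue_on S) \<and>
     integrable (lebesgue_on S) (\<lambda>x. (norm (f x))\<^sup>2)"

definition L2_norm :: "'a::euclidean_space set \<Rightarrow> ('a \<Rightarrow> 'b::euclidean_space) \<Rightarrow> real" where
  "L2_norm S f = sqrt (\<integral>x. (norm (f x))\<^sup>2 \<partial>lebesgue_on S)"

definition locally_integrable :: "('a::euclidean_space \<Rightarrow> 'b::euclidean_space) \<Rightarrow> bool" where
  "locally_integrable f \<longleftrightarrow> (\<forall>K. compact K \<longrightarrow> integrable (lebesgue_on K) f)"

definition part_deriv :: "'n::finite \<Rightarrow> (real^'n \<Rightarrow> real) \<Rightarrow> real^'n \<Rightarrow> real" where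
  "part_deriv i f x = frechet_derivative f (at x) (axis i 1)"

primrec Ck :: "nat \<Rightarrow> (real^'n::finite \<Rightarrow> real) \<Rightarrow> bool" where
  "Ck 0 f \<longleftrightarrow> continuous_on UNIV f"
| "Ck (Suc k) f \<longleftrightarrow> (\<forall>x. f differentiable (at x)) \<and> (\<forall>i. Ck k (part_deriv i f))"

definition test_functions :: "(real^'n::finite \<Rightarrow> real) set" where
  "test_functions = {\<phi>. (\<forall>k. Ck k \<phi>) \<and> compact (closure {x. \<phi> x \<noteq> 0})}"

text \<open>A distribution is represented by its action on functions; only its values on
  \<open>test_functions\<close> are meaningful, so equality of distributions means agreement there.\<close>

type_synonym 'n distr = "(real^'n \<Rightarrow> real) \<Rightarrow> real"

definition distr_eq :: "'n::finite distr \<Rightarrow> 'n distr \<Rightarrow> bool" where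
  "distr_eq S T \<longleftrightarrow> (\<forall>\<phi>\<in>test_functions. S \<phi> = T \<phi>)"

definition regular_distr :: "(real^'n::finite \<Rightarrow> real) \<Rightarrow> 'n distr" where
  "regular_distr f \<phi> = (\<integral>x. f x * \<phi> x \<partial>lebesgue)"

definition distr_deriv :: "'n::finite \<Rightarrow> 'n distr \<Rightarrow> 'n distr" where
  "distr_deriv i T \<phi> = - T (part_deriv i \<phi>)"

definition distr_laplacian :: "'n::finite distr \<Rightarrow> 'n distr" where
  "distr_laplacian T \<phi> = (\<Sum>i\<in>UNIV. distr_deriv i (distr_deriv i T) \<phi>)"

definition distr_div :: "('n::finite \<Rightarrow> 'n distr) \<Rightarrow> 'n distr" where
  "distr_div F \<phi> = (\<Sum>i\<in>UNIV. distr_deriv i (F i) \<phi>)"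

definition has_weak_gradient ::
    "(real^'n::finite \<Rightarrow> real) \<Rightarrow> (real^'n \<Rightarrow> real^'n) \<Rightarrow> bool" where
  "has_weak_gradient v g \<longleftrightarrow> locally_integrable v \<and> locally_integrable g \<and>
     (\<forall>i. distr_eq (distr_deriv i (regular_distr v)) (regular_distr (\<lambda>x. g x $ i)))"

text \<open>The weak gradient is determined up to a null set; \<open>weak_grad\<close> picks a representative.\<close>

definition weak_grad :: "(real^'n::finite \<Rightarrow> real) \<Rightarrow> real^'n \<Rightarrow> real^'n" where
  "weak_grad v = (SOME g. has_weak_gradient v g)"

definition weighted :: "(real^3 \<Rightarrow> real) \<Rightarrow> real^3 \<Rightarrow> real" where
  "weighted v x = ((norm x)\<^sup>2 + 1) powr (- 1 / 2) * v x"

text \<open>A distribution whose product with the smooth positive weight lies in \<open>L\<^sup>2\<close> is a locally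
  integrable function, so the space consists of functions, taken up to equality almost everywhere.\<close>

definition W10 :: "(real^3 \<Rightarrow> real) set" where
  "W10 = {v. L2_on UNIV (weighted v) \<and> (\<exists>g. has_weak_gradient v g \<and> L2_on UNIV g)}"

definition variational_solution ::
    "(real^3) set \<Rightarrow> (real^3 \<Rightarrow> real^3) \<Rightarrow> (real^3 \<Rightarrow> real) \<Rightarrow> bool" where
  "variational_solution \<Omega> M u \<longleftrightarrow> u \<in> W10 \<and>
     (\<forall>v\<in>W10. (\<integral>x. weak_grad u x \<bullet> weak_grad v x \<partial>lebesgue) =
               (\<integral>x. M x \<bullet> weak_grad v x \<partial>lebesgue_on \<Omega>))"

definition distributional_solution ::
    "(real^3) set \<Rightarrow> (real^3 \<Rightarrow> real^3) \<Rightarrow> (real^3 \<Rightarrow> real) \<Rightarrow> bool" where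
  "distributional_solution \<Omega> M u \<longleftrightarrow> u \<in> W10 \<and>
     distr_eq (distr_laplacian (regular_distr u))
       (distr_div (\<lambda>i. regular_distr (\<lambda>x. (indicator \<Omega> x *\<^sub>R M x) $ i)))"

end

theory Submission
  imports Defs
begin

text \<open>Hardy's inequality \<open>\<integral> \<phi>\<^sup>2 / (1 + |x|\<^sup>2) \<le> 4 \<integral> |\<nabla>\<phi>|\<^sup>2\<close> for test functions lets one project \<open>M \<chi>\<^sub>\<Omega>\<close>
  orthogonally onto the \<open>L\<^sup>2\<close> closure of the gradients of test functions: the projection is the gradient of
  a limit \<open>u\<close> in the weighted space, which solves the equation and satisfies both bounds. Uniqueness is
  a Liouville theorem: if \<open>z\<close> lies in the space and is weakly harmonic, the mollified partial derivatives
  of \<open>z\<close> are harmonic and vanish at infinity, so they are zero by the maximum principle; hence \<open>z\<close> is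
  constant, and the weight forces this constant to be zero. The same theorem, applied to the
  difference of \<open>v\<close> and the limit obtained by projecting \<open>\<nabla>v\<close>, shows that test functions are dense, which
  replaces the usual truncation and mollification argument.\<close>

section \<open>Smooth functions and bumps\<close>

text \<open>The distributional equation may be tested only with test functions, so the difference of
  two solutions cannot be tested with itself. Uniqueness therefore needs either density of test
  functions or a Liouville theorem, and the latter yields both. A member of the weighted space need
  not tend to zero pointwise, but its gradient lies in L2, and the convolution of an L2 function
  with a test function does vanish at infinity; this is why the maximum principle is applied to
  mollified partial derivatives and not to the function. Constants are excluded because a cube of
  side R has volume R^3, while the squared weight costs only a factor of order R^2. The constant 2
  is the square root of the 4 in Hardy's inequality, and that 4 comes from Young's inequality for
  the cross term in the divergence. All L2 objects remain functions: limits are integrals of squared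
  distances, and equalities hold almost everywhere.\<close>

definition smooth :: "(real^'n::finite \<Rightarrow> real) \<Rightarrow> bool" where
  "smooth f \<longleftrightarrow> (\<forall>k. Ck k f)"

lemma part_deriv_eq:
  assumes "(f has_derivative D) (at x)"
  shows "part_deriv i f x = D (axis i 1)"
  using frechet_derivative_at[OF assms] by (simp add: part_deriv_def)

lemma smoothD:
  assumes "smooth f"
  shows "f differentiable (at x)" "smooth (part_deriv i f)" "continuous_on UNIV f"
proof -
  show "f differentiable (at x)" "smooth (part_deriv i f)"
    using assms Ck.simps(2) unfolding smooth_def by blast+
  show "continuous_on UNIV f"
    using assms Ck.simps(1) unfolding smooth_def by blast
qed

text \<open>Since \<open>Ck\<close> recurses on the order, each closure property of smoothness would
  need its own induction. A family of differentiable functions that is stable under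
  \<open>part_deriv\<close> has all orders at once, so naming such a family is enough.\<close>

lemma smooth_coinduct:
  assumes "f \<in> A"
    and diff: "\<And>f x. f \<in> A \<Longrightarrow> f differentiable (at x)"
    and closed: "\<And>f i. f \<in> A \<Longrightarrow> part_deriv i f \<in> A"
  shows "smooth f"
proof -
  have "f \<in> A \<Longrightarrow> Ck k f" for k f
  proof (induction k arbitrary: f)
    case 0
    then show ?case
      by (simp add: continuous_at_imp_continuous_on differentiable_imp_continuous_within diff)
  next
    case (Suc k)
    then show ?case by (simp add: diff closed)
  qed
  then show ?thesis using assms(1) by (simp add: smooth_def)
qed

text \<open>A single shape \<open>a * f (c *\<^sub>R x + d) + b * g x\<close> covers linear
  combinations, translations, dilations and the reflection \<open>x - y\<close> of convolutions. It
  is stable under partial derivatives with \<open>c\<close> and \<open>d\<close> fixed, as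
  \<open>smooth_coinduct\<close> asks.\<close>

lemma has_derivative_affine_comb:
  fixes f g :: "real^'n::finite \<Rightarrow> real"
  assumes "f differentiable (at (c *\<^sub>R x + d))" "g differentiable (at x)"
  shows "((\<lambda>x. a * f (c *\<^sub>R x + d) + b * g x) has_derivative
    (\<lambda>h. a * frechet_derivative f (at (c *\<^sub>R x + d)) (c *\<^sub>R h) + b * frechet_derivative g (at x) h)) (at x)"
proof -
  have "(f has_derivative frechet_derivative f (at (c *\<^sub>R x + d))) (at (c *\<^sub>R x + d))"
    using assms(1) frechet_derivative_works by blast
  moreover have "((\<lambda>x. c *\<^sub>R x + d) has_derivative (\<lambda>h. c *\<^sub>R h)) (at x)"
    by (auto intro!: derivative_eq_intros)
  ultimately have 1: "((\<lambda>x. f (c *\<^sub>R x + d)) has_derivative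
      (\<lambda>h. frechet_derivative f (at (c *\<^sub>R x + d)) (c *\<^sub>R h))) (at x)"
    using diff_chain_at[of "\<lambda>x. c *\<^sub>R x + d" _ x f] by (simp add: o_def)
  have 2: "(g has_derivative frechet_derivative g (at x)) (at x)"
    using assms(2) frechet_derivative_works by blast
  show ?thesis
    by (intro has_derivative_add has_derivative_mult_right 1 2)
qed

lemma part_deriv_affine_comb:
  fixes f g :: "real^'n::finite \<Rightarrow> real"
  assumes "\<And>x. f differentiable (at x)" "\<And>x. g differentiable (at x)"
  shows "part_deriv i (\<lambda>x. a * f (c *\<^sub>R x + d) + b * g x) =
    (\<lambda>x. (a * c) * part_deriv i f (c *\<^sub>R x + d) + b * part_deriv i g x)"
proof
  fix x
  have "linear (frechet_derivative f (at (c *\<^sub>R x + d)))"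
    using assms(1) linear_frechet_derivative by blast
  then show "part_deriv i (\<lambda>x. a * f (c *\<^sub>R x + d) + b * g x) x =
      (a * c) * part_deriv i f (c *\<^sub>R x + d) + b * part_deriv i g x"
    by (subst part_deriv_eq[OF has_derivative_affine_comb[OF assms]]) (simp add: part_deriv_def linear_cmul)
qed

lemma smooth_affine_comb:
  assumes "smooth f" "smooth g"
  shows "smooth (\<lambda>x. a * f (c *\<^sub>R x + d) + b * g x)"
proof (rule smooth_coinduct[where A = "{\<lambda>x. a * f (c *\<^sub>R x + d) + b * g x |a b f g. smooth f \<and> smooth g}"])
  show "(\<lambda>x. a * f (c *\<^sub>R x + d) + b * g x) \<in> {\<lambda>x. a * f (c *\<^sub>R x + d) + b * g x |a b f g. smooth f \<and> smooth g}"
    using assms by blast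
next
  fix h :: "real^'a \<Rightarrow> real" and x
  assume "h \<in> {\<lambda>x. a * f (c *\<^sub>R x + d) + b * g x |a b f g. smooth f \<and> smooth g}"
  then obtain a b f g where h: "h = (\<lambda>x. a * f (c *\<^sub>R x + d) + b * g x)" "smooth f" "smooth g"
    by blast
  show "h differentiable (at x)"
    unfolding h(1) using has_derivative_affine_comb[OF smoothD(1)[OF h(2)] smoothD(1)[OF h(3)]]
    by (rule differentiableI)
next
  fix h :: "real^'a \<Rightarrow> real" and i
  assume "h \<in> {\<lambda>x. a * f (c *\<^sub>R x + d) + b * g x |a b f g. smooth f \<and> smooth g}"
  then obtain a b f g where h: "h = (\<lambda>x. a * f (c *\<^sub>R x + d) + b * g x)" "smooth f" "smooth g"
    by blast
  show "part_deriv i h \<in> {\<lambda>x. a * f (c *\<^sub>R x + d) + b * g x |a b f g. smooth f \<and> smooth g}"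
    unfolding h(1) part_deriv_affine_comb[OF smoothD(1)[OF h(2)] smoothD(1)[OF h(3)]]
    using smoothD(2)[OF h(2)] smoothD(2)[OF h(3)] by blast
qed

section \<open>Test functions and their gradients\<close>

lemma test_functions_iff:
  "\<phi> \<in> test_functions \<longleftrightarrow> smooth \<phi> \<and> (\<exists>r>0. \<forall>x. r < norm x \<longrightarrow> \<phi> x = 0)"
proof -
  have "compact (closure {x. \<phi> x \<noteq> 0}) \<longleftrightarrow> (\<exists>r>0. \<forall>x. r < norm x \<longrightarrow> \<phi> x = 0)"
    unfolding compact_closure bounded_pos
    by (intro arg_cong[where f = Ex] ext conj_cong refl) (auto simp flip: not_le)
  then show ?thesis by (auto simp: test_functions_def smooth_def)
qed

lemma test_functionsE:
  assumes "\<phi> \<in> test_functions"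
  obtains r where "r > 0" "\<And>x. r < norm x \<Longrightarrow> \<phi> x = 0"
  using assms unfolding test_functions_iff by blast

lemma test_affine_comb:
  assumes "\<phi> \<in> test_functions" "\<psi> \<in> test_functions" "c \<noteq> 0"
  shows "(\<lambda>x. a * \<phi> (c *\<^sub>R x + d) + b * \<psi> x) \<in> test_functions"
proof -
  obtain r where r: "r > 0" "\<And>x. r < norm x \<Longrightarrow> \<phi> x = 0" using assms(1) test_functionsE by blast
  obtain s where s: "s > 0" "\<And>x. s < norm x \<Longrightarrow> \<psi> x = 0" using assms(2) test_functionsE by blast
  \<comment> \<open>Beyond this radius \<open>\<bar>c\<bar> * norm x - norm d\<close> exceeds
    \<open>r\<close>, so the transformed point has left the support of
    \<open>\<phi>\<close>.\<close>
  have "\<phi> (c *\<^sub>R x + d) = 0 \<and> \<psi> x = 0" if "max s ((r + norm d) / \<bar>c\<bar>) < norm x" for x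
  proof -
    have "r + norm d < \<bar>c\<bar> * norm x"
      using that assms(3) by (simp add: field_simps)
    moreover have "norm (c *\<^sub>R x) \<le> norm (c *\<^sub>R x + d) + norm d"
      using norm_triangle_ineq4[of "c *\<^sub>R x + d" d] by simp
    ultimately have "r < norm (c *\<^sub>R x + d)" by simp
    then show ?thesis using r s that by simp
  qed
  then have "\<exists>r>0. \<forall>x. r < norm x \<longrightarrow> a * \<phi> (c *\<^sub>R x + d) + b * \<psi> x = 0"
    using s(1) by (intro exI[of _ "max s ((r + norm d) / \<bar>c\<bar>)"]) auto
  then show ?thesis
    using smooth_affine_comb assms unfolding test_functions_iff by blast
qed

lemma test_comb:
  assumes "\<phi> \<in> test_functions" "\<psi> \<in> test_functions"
  shows "(\<lambda>x. a * \<phi> x + b * \<psi> x) \<in> test_functions"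
  using test_affine_comb[OF assms, of 1 a 0 b] by simp

lemma test_affine:
  assumes "\<phi> \<in> test_functions" "c \<noteq> 0"
  shows "(\<lambda>x. \<phi> (c *\<^sub>R x + d)) \<in> test_functions"
  using test_affine_comb[OF assms(1) assms(1) assms(2), of 1 d 0] by simp

lemma test_part_deriv:
  assumes "\<phi> \<in> test_functions"
  shows "part_deriv i \<phi> \<in> test_functions"
proof -
  obtain r where r: "r > 0" "\<And>x. r < norm x \<Longrightarrow> \<phi> x = 0" using assms test_functionsE by blast
  have "part_deriv i \<phi> x = 0" if "r < norm x" for x
  proof -
    have "open {x::real^'a. r < norm x}"
      by (intro open_Collect_less continuous_intros)
    then have "(\<phi> has_derivative (\<lambda>h. 0)) (at x)"
      using that r(2) by (intro has_derivative_transform_within_open[OF has_derivative_const, of "{x. r < norm x}" x 0 \<phi>]) auto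
    then show ?thesis using part_deriv_eq by fastforce
  qed
  then have "\<exists>r>0. \<forall>x. r < norm x \<longrightarrow> part_deriv i \<phi> x = 0"
    using r(1) by blast
  then show ?thesis using assms smoothD(2)[of \<phi> i] by (simp add: test_functions_iff)
qed

lemma test_continuous:
  "\<phi> \<in> test_functions \<Longrightarrow> continuous_on UNIV \<phi>"
  by (simp add: test_functions_iff smoothD)

definition grad :: "(real^'n::finite \<Rightarrow> real) \<Rightarrow> real^'n \<Rightarrow> real^'n" where
  "grad f x = (\<chi> i. part_deriv i f x)"

lemma has_derivative_grad:
  assumes "f differentiable (at x)"
  shows "(f has_derivative (\<lambda>h. grad f x \<bullet> h)) (at x)"
proof -
  have D: "(f has_derivative frechet_derivative f (at x)) (at x)"
    using assms frechet_derivative_works by blast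
  then have lin: "linear (frechet_derivative f (at x))"
    using has_derivative_linear by blast
  have "frechet_derivative f (at x) h = grad f x \<bullet> h" for h :: "real^'a"
  proof -
    have "frechet_derivative f (at x) h = frechet_derivative f (at x) (\<Sum>i\<in>UNIV. (h $ i) *\<^sub>R axis i 1)"
      by (simp add: basis_expansion flip: scalar_mult_eq_scaleR)
    also have "\<dots> = (\<Sum>i\<in>UNIV. h $ i * part_deriv i f x)"
      by (simp add: linear_sum[OF lin] linear_cmul[OF lin] part_deriv_def)
    finally show ?thesis by (simp add: grad_def inner_vec_def mult.commute)
  qed
  then show ?thesis using D by presburger
qed

lemma test_has_derivative:
  "\<phi> \<in> test_functions \<Longrightarrow> (\<phi> has_derivative (\<lambda>h. grad \<phi> x \<bullet> h)) (at x)"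
  by (simp add: has_derivative_grad smoothD test_functions_iff)

lemma test_grad_continuous:
  "\<phi> \<in> test_functions \<Longrightarrow> continuous_on UNIV (grad \<phi>)"
  unfolding grad_def
  by (intro continuous_on_vec_lambda) (simp add: test_continuous test_part_deriv)

lemma test_part_deriv_comb:
  assumes "\<phi> \<in> test_functions" "\<psi> \<in> test_functions"
  shows "part_deriv i (\<lambda>x. a * \<phi> x + b * \<psi> x) = (\<lambda>x. a * part_deriv i \<phi> x + b * part_deriv i \<psi> x)"
  using part_deriv_affine_comb[of \<phi> \<psi> i a 1 0 b] assms by (simp add: test_functions_iff smoothD)

lemma test_grad_comb:
  assumes "\<phi> \<in> test_functions" "\<psi> \<in> test_functions"
  shows "grad (\<lambda>x. a * \<phi> x + b * \<psi> x) x = a *\<^sub>R grad \<phi> x + b *\<^sub>R grad \<psi> x"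
  by (simp add: grad_def vec_eq_iff test_part_deriv_comb[OF assms])

lemma part_deriv_affine:
  assumes "\<phi> \<in> test_functions"
  shows "part_deriv i (\<lambda>x. \<phi> (c *\<^sub>R x + d)) = (\<lambda>x. c * part_deriv i \<phi> (c *\<^sub>R x + d))"
  using part_deriv_affine_comb[of \<phi> \<phi> i 1 c d 0] assms by (simp add: test_functions_iff smoothD)

section \<open>Flat functions and smooth bumps on boxes\<close>

text \<open>Closed under differentiation: the derivative of \<open>flat k\<close> is \<open>flat (k + 2) - k flat (k + 1)\<close>.\<close>

definition flat :: "nat \<Rightarrow> real \<Rightarrow> real" where
  "flat k t = (if 0 < t then exp (- (1 / t)) / t ^ k else 0)"

text \<open>With \<open>s = 1 / t\<close> this is the decay of \<open>s ^ k / exp s\<close> as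
  \<open>s\<close> grows; to the left of 0 the function is identically zero.\<close>

lemma flat_tendsto_0: "(flat k \<longlongrightarrow> 0) (at 0)"
proof (rule filterlim_split_at)
  show "(flat k \<longlongrightarrow> 0) (at_left 0)"
    by (rule tendsto_eventually) (auto simp: flat_def eventually_at_filter)
  have "((\<lambda>t::real. inverse t ^ k / exp (inverse t)) \<longlongrightarrow> 0) (at_right 0)"
    by (rule filterlim_compose[OF tendsto_power_div_exp_0 filterlim_inverse_at_top_right])
  then show "(flat k \<longlongrightarrow> 0) (at_right 0)"
    by (rule Lim_transform_eventually)
      (auto simp: flat_def eventually_at_filter exp_minus field_simps)
qed

lemma flat_has_derivative:
  "(flat k has_real_derivative flat (k + 2) t - real k * flat (k + 1) t) (at t)"
proof -
  consider "t < 0" | "t = 0" | "t > 0" by linarith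
  then show ?thesis
  proof cases
    case 1
    have "(flat k has_real_derivative 0) (at t)"
      by (rule has_field_derivative_transform_within_open[of "\<lambda>_. 0" 0 t "{..<0}"]) (use 1 in \<open>auto simp: flat_def\<close>)
    then show ?thesis using 1 by (simp add: flat_def)
  next
    case 2
    \<comment> \<open>The difference quotient of \<open>flat k\<close> at 0 is
      \<open>flat (Suc k)\<close>, so differentiability at 0 costs nothing beyond the limit already
      known.\<close>
    have "((\<lambda>h. (flat k (0 + h) - flat k 0) / h) \<longlongrightarrow> 0) (at 0)"
      by (rule Lim_transform_eventually[OF flat_tendsto_0[of "Suc k"]])
        (auto simp: flat_def eventually_at_filter)
    then show ?thesis using 2 by (simp add: DERIV_def flat_def)
  next
    case 3
    \<comment> \<open>The derivative of \<open>t ^ k\<close> has the exponent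
      \<open>k - Suc 0\<close>, which truncates at \<open>k = 0\<close>; the factor
      \<open>real k\<close> makes both sides vanish there.\<close>
    have "real k * t ^ (k - Suc 0) = real k * t ^ k / t"
      using 3 by (cases k) auto
    then have "((\<lambda>t. exp (- (1 / t)) / t ^ k) has_real_derivative flat (k + 2) t - real k * flat (k + 1) t) (at t)"
      using 3 by (auto intro!: derivative_eq_intros simp: flat_def field_simps power2_eq_square)
    then show ?thesis
      by (rule has_field_derivative_transform_within_open[of _ _ t "{0<..}"]) (use 3 in \<open>auto simp: flat_def\<close>)
  qed
qed

text \<open>The family fed to \<open>smooth_coinduct\<close> for the bumps. Arguments of
  \<open>flat\<close> are affine functions of one coordinate, so that the chain rule contributes
  only a constant factor; all \<open>k\<close> occur because differentiation raises
  \<open>k\<close>.\<close>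

inductive_set flat_algebra :: "(real^'n::finite \<Rightarrow> real) set" where
  const: "(\<lambda>x. c) \<in> flat_algebra"
| comp: "(\<lambda>x. flat k (a * x $ i + b)) \<in> flat_algebra"
| add: "f \<in> flat_algebra \<Longrightarrow> g \<in> flat_algebra \<Longrightarrow> (\<lambda>x. f x + g x) \<in> flat_algebra"
| mult: "f \<in> flat_algebra \<Longrightarrow> g \<in> flat_algebra \<Longrightarrow> (\<lambda>x. f x * g x) \<in> flat_algebra"

lemma flat_algebra_deriv:
  "f \<in> flat_algebra \<Longrightarrow> (\<forall>x. f differentiable (at x)) \<and> part_deriv j f \<in> flat_algebra"
proof (induction rule: flat_algebra.induct)
  case (const c)
  have "part_deriv j (\<lambda>x::real^'a. c) = (\<lambda>x. 0)"
    by (rule ext) (simp add: part_deriv_eq[OF has_derivative_const])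
  then show ?case by (simp add: flat_algebra.const)
next
  case (comp k a i b)
  have D: "((\<lambda>x::real^'a. flat k (a * x $ i + b)) has_derivative
    (\<lambda>h. (a * h $ i) * (flat (k + 2) (a * x $ i + b) - real k * flat (k + 1) (a * x $ i + b)))) (at x)" for x
  proof -
    have "((\<lambda>x::real^'a. a * x $ i + b) has_derivative (\<lambda>h. a * h $ i)) (at x)"
      by (auto intro!: derivative_eq_intros bounded_linear_imp_has_derivative bounded_linear_vec_nth)
    from has_derivative_compose[OF this flat_has_derivative[THEN has_field_derivative_imp_has_derivative]]
    show ?thesis by (simp add: mult.commute)
  qed
  have "part_deriv j (\<lambda>x::real^'a. flat k (a * x $ i + b)) =
      (\<lambda>x. (a * axis j 1 $ i) * (flat (k + 2) (a * x $ i + b) + (- real k) * flat (k + 1) (a * x $ i + b)))"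
    by (rule ext) (simp add: part_deriv_eq[OF D])
  moreover have "(\<lambda>x. (a * axis j 1 $ i) * (flat (k + 2) (a * x $ i + b) + (- real k) * flat (k + 1) (a * x $ i + b)))
     \<in> flat_algebra"
    by (intro flat_algebra.intros)
  ultimately show ?case using D unfolding differentiable_def by auto
next
  case (add f g)
  have D: "((\<lambda>x. f x + g x) has_derivative (\<lambda>h. frechet_derivative f (at x) h + frechet_derivative g (at x) h)) (at x)" for x
    using add frechet_derivative_works by (intro has_derivative_add) blast+
  have "part_deriv j (\<lambda>x. f x + g x) = (\<lambda>x. part_deriv j f x + part_deriv j g x)"
    by (rule ext, subst part_deriv_eq[OF D]) (simp add: part_deriv_def)
  then show ?case using add D unfolding differentiable_def by (auto intro: flat_algebra.add)
next
  case (mult f g)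
  have D: "((\<lambda>x. f x * g x) has_derivative (\<lambda>h. f x * frechet_derivative g (at x) h + frechet_derivative f (at x) h * g x)) (at x)" for x
    using mult frechet_derivative_works by (intro has_derivative_mult) blast+
  have "part_deriv j (\<lambda>x. f x * g x) = (\<lambda>x. f x * part_deriv j g x + part_deriv j f x * g x)"
    by (rule ext, subst part_deriv_eq[OF D]) (simp add: part_deriv_def)
  then show ?case using mult D unfolding differentiable_def
    by (auto intro: flat_algebra.add flat_algebra.mult)
qed

lemma flat_algebra_smooth: "f \<in> flat_algebra \<Longrightarrow> smooth f"
  using smooth_coinduct[of f flat_algebra] flat_algebra_deriv by blast

lemma flat_algebra_prod:
  "finite I \<Longrightarrow> (\<And>i. i \<in> I \<Longrightarrow> f i \<in> flat_algebra) \<Longrightarrow> (\<lambda>x. \<Prod>i\<in>I. f i x) \<in> flat_algebra"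
proof (induction I rule: finite_induct)
  case empty
  then show ?case by (simp add: flat_algebra.const)
next
  case (insert i I)
  then show ?case by (simp add: flat_algebra.mult)
qed

text \<open>Each factor is
  \<open>flat 0 (n * (x $ i - a $ i)) * flat 0 (n * (b $ i - x $ i))\<close>, expanded to fit
  \<open>flat_algebra.comp\<close>. As \<open>n\<close> grows, \<open>exp (- (1 / (n * t)))\<close>
  tends to 1 for every \<open>t > 0\<close>, so these test functions approximate the indicator of
  the open box from below.\<close>

definition box_bump :: "real^'n::finite \<Rightarrow> real^'n \<Rightarrow> nat \<Rightarrow> real^'n \<Rightarrow> real" where
  "box_bump a b n x = (\<Prod>i\<in>UNIV. flat 0 (real n * x $ i + - (real n * a $ i)) *
    flat 0 (- real n * x $ i + real n * b $ i))"

lemma flat_0_bounds: "0 \<le> flat 0 t" "flat 0 t \<le> 1"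
  by (auto simp: flat_def)

lemma box_bump_bounds: "0 \<le> box_bump a b n x" "box_bump a b n x \<le> 1"
  unfolding box_bump_def by (auto intro!: prod_nonneg prod_le_1 mult_le_one flat_0_bounds mult_nonneg_nonneg)

lemma box_bump_eq_0:
  assumes "x \<notin> box a b"
  shows "box_bump a b n x = 0"
proof -
  obtain i where "x $ i \<le> a $ i \<or> b $ i \<le> x $ i"
    using assms by (auto simp: mem_box_cart not_less)
  then have "flat 0 (real n * x $ i + - (real n * a $ i)) * flat 0 (- real n * x $ i + real n * b $ i) = 0"
    by (auto simp: flat_def mult_less_cancel_left dest: leD)
  then show ?thesis unfolding box_bump_def by (intro prod_zero) auto
qed

lemma box_bump_test: "box_bump a b n \<in> test_functions"
proof -
  have "(\<lambda>x. \<Prod>i\<in>UNIV. flat 0 (real n * x $ i + - (real n * a $ i)) *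
    flat 0 (- real n * x $ i + real n * b $ i)) \<in> flat_algebra"
    by (intro flat_algebra_prod flat_algebra.mult flat_algebra.comp) auto
  then have "smooth (box_bump a b n)"
    using flat_algebra_smooth unfolding box_bump_def[abs_def] by blast
  moreover obtain r where "r > 0" "\<forall>x\<in>box a b. norm x \<le> r"
    using bounded_box bounded_pos by blast
  then have "\<exists>r>0. \<forall>x. r < norm x \<longrightarrow> box_bump a b n x = 0"
    by (metis box_bump_eq_0 linorder_not_less)
  ultimately show ?thesis by (simp add: test_functions_iff)
qed

lemma flat_0_scaled_tendsto:
  assumes "t > 0"
  shows "(\<lambda>n. flat 0 (real n * t)) \<longlonglongrightarrow> 1"
proof -
  have "(\<lambda>n. exp (- (1 / real n / t))) \<longlonglongrightarrow> exp (- (0 / t))"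
    using assms by (intro tendsto_intros lim_1_over_n) auto
  then have "(\<lambda>n. exp (- (1 / real n / t))) \<longlonglongrightarrow> 1" by simp
  moreover have "\<forall>\<^sub>F n in sequentially. exp (- (1 / real n / t)) = flat 0 (real n * t)"
    using eventually_gt_at_top[of 0] by eventually_elim (use assms in \<open>auto simp: flat_def\<close>)
  ultimately show ?thesis by (rule Lim_transform_eventually)
qed

lemma box_bump_tendsto: "(\<lambda>n. box_bump a b n x) \<longlonglongrightarrow> indicator (box a b) x"
proof (cases "x \<in> box a b")
  case True
  have "(\<lambda>n. \<Prod>i\<in>UNIV. flat 0 (real n * (x $ i - a $ i)) * flat 0 (real n * (b $ i - x $ i))) \<longlonglongrightarrow> (\<Prod>i\<in>(UNIV::'a set). 1 * 1)"
    using True by (intro tendsto_prod tendsto_mult flat_0_scaled_tendsto) (auto simp: mem_box_cart)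
  then show ?thesis using True by (simp add: box_bump_def algebra_simps)
qed (simp add: box_bump_eq_0)

lemma box_bump_translate:
  "box_bump (a + h) (b + h) n (x + h) = box_bump a b n x"
  by (simp add: box_bump_def algebra_simps)

section \<open>Square integrable functions\<close>

definition sq_integrable :: "'a measure \<Rightarrow> ('a \<Rightarrow> 'b::euclidean_space) \<Rightarrow> bool" where
  "sq_integrable M f \<longleftrightarrow> f \<in> borel_measurable M \<and> integrable M (\<lambda>x. (norm (f x))\<^sup>2)"

lemma L2_on_eq: "L2_on S = sq_integrable (lebesgue_on S)"
  by (simp add: fun_eq_iff L2_on_def sq_integrable_def)

lemma sq_integrable_measurable[measurable_dest]: "sq_integrable M f \<Longrightarrow> f \<in> borel_measurable M"
  by (simp add: sq_integrable_def)

lemma sq_integrable_inner: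
  assumes "sq_integrable M f" "sq_integrable M g"
  shows "integrable M (\<lambda>x. f x \<bullet> g x)"
proof (rule Bochner_Integration.integrable_bound)
  show "integrable M (\<lambda>x. (norm (f x))\<^sup>2 + (norm (g x))\<^sup>2)"
    using assms by (simp add: sq_integrable_def)
  show "(\<lambda>x. f x \<bullet> g x) \<in> borel_measurable M"
    using assms[THEN sq_integrable_measurable] by simp
  have "norm (f x \<bullet> g x) \<le> norm ((norm (f x))\<^sup>2 + (norm (g x))\<^sup>2)" for x
  proof -
    have "\<bar>f x \<bullet> g x\<bar> \<le> norm (f x) * norm (g x)" by (rule Cauchy_Schwarz_ineq2)
    also have "\<dots> \<le> (norm (f x))\<^sup>2 + (norm (g x))\<^sup>2"
      using sum_squares_bound[of "norm (f x)" "norm (g x)"]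
        mult_nonneg_nonneg[OF norm_ge_zero norm_ge_zero, of "f x" "g x"] by linarith
    finally show ?thesis by simp
  qed
  then show "AE x in M. norm (f x \<bullet> g x) \<le> norm ((norm (f x))\<^sup>2 + (norm (g x))\<^sup>2)" by simp
qed

lemma sq_integrable_comb:
  assumes "sq_integrable M f" "sq_integrable M g"
  shows "sq_integrable M (\<lambda>x. a *\<^sub>R f x + b *\<^sub>R g x)"
proof -
  have "(norm (a *\<^sub>R f x + b *\<^sub>R g x))\<^sup>2 = a\<^sup>2 * (norm (f x))\<^sup>2 + 2 * a * b * (f x \<bullet> g x) + b\<^sup>2 * (norm (g x))\<^sup>2" for x
    by (simp only: power2_norm_eq_inner) (simp add: algebra_simps inner_commute power2_eq_square)
  moreover have "integrable M (\<lambda>x. a\<^sup>2 * (norm (f x))\<^sup>2 + 2 * a * b * (f x \<bullet> g x) + b\<^sup>2 * (norm (g x))\<^sup>2)"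
    using assms sq_integrable_inner[OF assms] by (simp add: sq_integrable_def)
  ultimately show ?thesis
    using assms[THEN sq_integrable_measurable] by (simp add: sq_integrable_def)
qed

lemma sq_integrable_diff:
  assumes "sq_integrable M f" "sq_integrable M g"
  shows "sq_integrable M (\<lambda>x. f x - g x)"
  using sq_integrable_comb[OF assms, of 1 "-1"] by simp

lemma integral_norm_sq_comb:
  assumes "sq_integrable M f" "sq_integrable M g"
  shows "(\<integral>x. (norm (f x + t *\<^sub>R g x))\<^sup>2 \<partial>M) =
    (\<integral>x. (norm (f x))\<^sup>2 \<partial>M) + 2 * t * (\<integral>x. f x \<bullet> g x \<partial>M) + t\<^sup>2 * (\<integral>x. (norm (g x))\<^sup>2 \<partial>M)"
proof -
  have "(norm (f x + t *\<^sub>R g x))\<^sup>2 = (norm (f x))\<^sup>2 + 2 * t * (f x \<bullet> g x) + t\<^sup>2 * (norm (g x))\<^sup>2" for x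
    by (simp only: power2_norm_eq_inner) (simp add: algebra_simps inner_commute power2_eq_square)
  then show ?thesis
    using assms sq_integrable_inner[OF assms] by (simp add: sq_integrable_def)
qed

text \<open>The value at the minimiser \<open>- b / c\<close> must be nonnegative. This gives
  Cauchy-Schwarz here and, later, the near-orthogonality of a minimising sequence.\<close>

lemma discriminant_le:
  fixes a b c :: real
  assumes "\<And>t. 0 \<le> a + 2 * t * b + t\<^sup>2 * c" "0 \<le> c"
  shows "b\<^sup>2 \<le> a * c"
proof (cases "c = 0")
  case True
  have "b = 0"
  proof (rule ccontr)
    assume "b \<noteq> 0"
    \<comment> \<open>For \<open>c = 0\<close> the quadratic is affine, and this \<open>t\<close>
      gives it the value -1.\<close>
    then show False using assms(1)[of "- (a + 1) / (2 * b)"] True by (simp add: field_simps)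
  qed
  then show ?thesis using True by simp
next
  case False
  have "0 \<le> c * (a + 2 * (- b / c) * b + (- b / c)\<^sup>2 * c)"
    by (rule mult_nonneg_nonneg[OF assms(2) assms(1)])
  also have "\<dots> = a * c - b\<^sup>2"
    using False by (simp add: field_simps power2_eq_square)
  finally show ?thesis by simp
qed

lemma Cauchy_Schwarz_integral:
  assumes "sq_integrable M f" "sq_integrable M g"
  shows "(\<integral>x. f x \<bullet> g x \<partial>M)\<^sup>2 \<le> (\<integral>x. (norm (f x))\<^sup>2 \<partial>M) * (\<integral>x. (norm (g x))\<^sup>2 \<partial>M)"
proof (rule discriminant_le)
  show "0 \<le> (\<integral>x. (norm (f x))\<^sup>2 \<partial>M) + 2 * t * (\<integral>x. f x \<bullet> g x \<partial>M) + t\<^sup>2 * (\<integral>x. (norm (g x))\<^sup>2 \<partial>M)" for t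
    unfolding integral_norm_sq_comb[OF assms, symmetric] by simp
qed simp

lemma L2_limit_inner:
  assumes f: "\<And>n. sq_integrable M (f n)" and g: "sq_integrable M g" and h: "sq_integrable M h"
    and lim: "(\<lambda>n. \<integral>x. (norm (f n x - g x))\<^sup>2 \<partial>M) \<longlonglongrightarrow> 0"
  shows "(\<lambda>n. \<integral>x. f n x \<bullet> h x \<partial>M) \<longlonglongrightarrow> (\<integral>x. g x \<bullet> h x \<partial>M)"
proof -
  have "(\<lambda>n. (\<integral>x. (norm (f n x - g x))\<^sup>2 \<partial>M) * (\<integral>x. (norm (h x))\<^sup>2 \<partial>M)) \<longlonglongrightarrow> 0"
    using lim tendsto_mult_left_zero by blast
  then have "(\<lambda>n. (\<integral>x. (f n x - g x) \<bullet> h x \<partial>M)\<^sup>2) \<longlonglongrightarrow> 0"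
    by (rule Lim_null_comparison[rotated])
      (auto intro!: Cauchy_Schwarz_integral sq_integrable_diff assms eventuallyI)
  then have "(\<lambda>n. \<integral>x. (f n x - g x) \<bullet> h x \<partial>M) \<longlonglongrightarrow> 0"
    by (subst (asm) power_tendsto_0_iff) auto
  moreover have "(\<integral>x. (f n x - g x) \<bullet> h x \<partial>M) = (\<integral>x. f n x \<bullet> h x \<partial>M) - (\<integral>x. g x \<bullet> h x \<partial>M)" for n
    by (simp add: inner_diff_left sq_integrable_inner f g h)
  ultimately show ?thesis by (simp add: LIM_zero_iff)
qed

lemma L2_limit_norm:
  assumes f: "\<And>n. sq_integrable M (f n)" and g: "sq_integrable M g"
    and lim: "(\<lambda>n. \<integral>x. (norm (f n x - g x))\<^sup>2 \<partial>M) \<longlonglongrightarrow> 0"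
  shows "(\<lambda>n. \<integral>x. (norm (f n x))\<^sup>2 \<partial>M) \<longlonglongrightarrow> (\<integral>x. (norm (g x))\<^sup>2 \<partial>M)"
proof -
  have "(\<integral>x. (norm (f n x))\<^sup>2 \<partial>M) = (\<integral>x. (norm (f n x - g x))\<^sup>2 \<partial>M) +
      2 * (\<integral>x. f n x \<bullet> g x \<partial>M) - (\<integral>x. (norm (g x))\<^sup>2 \<partial>M)" for n
    using integral_norm_sq_comb[OF f g, of n "-1"] by simp
  moreover have "(\<lambda>n. (\<integral>x. (norm (f n x - g x))\<^sup>2 \<partial>M) +
      2 * (\<integral>x. f n x \<bullet> g x \<partial>M) - (\<integral>x. (norm (g x))\<^sup>2 \<partial>M)) \<longlonglongrightarrow>
      0 + 2 * (\<integral>x. g x \<bullet> g x \<partial>M) - (\<integral>x. (norm (g x))\<^sup>2 \<partial>M)"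
    by (intro tendsto_intros lim L2_limit_inner[OF f g g lim])
  ultimately show ?thesis by (simp add: power2_norm_eq_inner)
qed

text \<open>The rate 1/4 is split: the weight \<open>2^n\<close> uses up one factor 1/2 per step and
  leaves a convergent geometric series, so the weighted sum has finite integral and is finite almost
  everywhere. Its value bounds every term, which is the pointwise rate 1/2.\<close>

lemma weighted_sum_finite_AE:
  fixes d :: "nat \<Rightarrow> 'a \<Rightarrow> real"
  assumes d: "\<And>n. integrable M (d n)" "\<And>n x. 0 \<le> d n x" "\<And>n. (\<integral>x. d n x \<partial>M) \<le> K * (1/4)^n"
  shows "AE x in M. \<exists>C. \<forall>n. d n x \<le> C * (1/2)^n"
proof -
  have K: "0 \<le> K" using d(3)[of 0] Bochner_Integration.integral_nonneg[of M "d 0", OF d(2)] by simp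
  have [measurable]: "d n \<in> borel_measurable M" for n using d(1) by auto
  have "(\<integral>\<^sup>+x. (\<Sum>n. ennreal (2^n * d n x)) \<partial>M) = (\<Sum>n. \<integral>\<^sup>+x. ennreal (2^n * d n x) \<partial>M)"
    by (rule nn_integral_suminf) measurable
  also have "\<dots> = (\<Sum>n. ennreal (2^n * (\<integral>x. d n x \<partial>M)))"
    by (subst nn_integral_eq_integral) (use d in auto)
  also have "\<dots> \<le> (\<Sum>n. ennreal (K * (1/2)^n))"
  proof (intro suminf_le summableI ennreal_leI)
    fix n :: nat
    have "2^n * (\<integral>x. d n x \<partial>M) \<le> 2^n * (K * (1/4)^n)" by (intro mult_left_mono d) auto
    also have "\<dots> = K * (2 * (1/4))^n" by (simp only: power_mult_distrib) simp
    finally show "2^n * (\<integral>x. d n x \<partial>M) \<le> K * (1/2)^n" by simp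
  qed
  also have "\<dots> = ennreal (\<Sum>n. K * (1/2)^n)"
    by (intro suminf_ennreal2 summable_mult summable_geometric) (use K in auto)
  finally have "(\<integral>\<^sup>+x. (\<Sum>n. ennreal (2^n * d n x)) \<partial>M) \<noteq> \<infinity>"
    by (metis ennreal_neq_top infinity_ennreal_def top_unique)
  then have "AE x in M. (\<Sum>n. ennreal (2^n * d n x)) \<noteq> \<infinity>"
    by (intro nn_integral_PInf_AE) measurable
  then show ?thesis
  proof eventually_elim
    case (elim x)
    then obtain C where C: "(\<Sum>n. ennreal (2^n * d n x)) = ennreal C" "0 \<le> C"
      by (cases "\<Sum>n. ennreal (2^n * d n x)") auto
    have "d n x \<le> C * (1/2)^n" for n
    proof -
      have "ennreal (2^n * d n x) \<le> (\<Sum>n. ennreal (2^n * d n x))"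
        using sum_le_suminf[OF summableI, of "{n}" "\<lambda>n. ennreal (2^n * d n x)"] by simp
      then have "2^n * d n x \<le> C" using C by simp
      then show ?thesis by (simp add: power_divide field_simps)
    qed
    then show ?case by blast
  qed
qed

text \<open>Asking for a geometric rate avoids passing to a subsequence, and minimising sequences
  can be chosen with that rate. The pointwise limit exists almost everywhere, and Fatou's lemma,
  applied in \<open>m\<close> with \<open>n\<close> fixed, carries the Cauchy estimate over to
  it.\<close>

theorem Riesz_Fischer_fast:
  fixes f :: "nat \<Rightarrow> 'a \<Rightarrow> 'b::euclidean_space"
  assumes f: "\<And>n. sq_integrable M (f n)"
    and cauchy: "\<And>m n. n \<le> m \<Longrightarrow> (\<integral>x. (norm (f m x - f n x))\<^sup>2 \<partial>M) \<le> K * (1/4)^n"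
  obtains g where "sq_integrable M g" "(\<lambda>n. \<integral>x. (norm (f n x - g x))\<^sup>2 \<partial>M) \<longlonglongrightarrow> 0"
proof -
  have [measurable]: "f n \<in> borel_measurable M" for n using f by (simp add: sq_integrable_def)
  have int: "integrable M (\<lambda>x. (norm (f m x - f n x))\<^sup>2)" for m n
    using sq_integrable_diff[OF f f] by (simp add: sq_integrable_def)
  have "AE x in M. \<exists>C. \<forall>n. (norm (f (Suc n) x - f n x))\<^sup>2 \<le> C * (1/2)^n"
    using int cauchy by (intro weighted_sum_finite_AE[where K = K]) auto
  then have conv: "AE x in M. convergent (\<lambda>n. f n x)"
  proof eventually_elim
    case (elim x)
    then obtain C where C: "\<And>n. (norm (f (Suc n) x - f n x))\<^sup>2 \<le> C * (1/2)^n" by blast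
    \<comment> \<open>Square roots turn the rate 1/2 into \<open>sqrt (1/2)\<close>, still below 1,
      so the telescoping series converges absolutely.\<close>
    have le: "norm (f (Suc n) x - f n x) \<le> sqrt C * (sqrt (1/2))^n" for n
      using real_le_rsqrt[OF C[of n]] by (simp only: real_sqrt_mult real_sqrt_power)
    have "summable (\<lambda>n. sqrt C * (sqrt (1/2))^n)"
      by (intro summable_mult summable_geometric) (simp add: real_sqrt_lt_1_iff)
    from summable_comparison_test'[OF this le] have "summable (\<lambda>n. f (Suc n) x - f n x)" .
    then have "convergent (\<lambda>n. \<Sum>k<n. f (Suc k) x - f k x)"
      by (simp add: summable_iff_convergent)
    then have "convergent (\<lambda>n. f n x - f 0 x)" by (simp only: sum_lessThan_telescope[of "\<lambda>n. f n x"])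
    then have "convergent (\<lambda>n. (f n x - f 0 x) + f 0 x)"
      by (intro convergent_add convergent_const)
    then show ?case by simp
  qed
  \<comment> \<open>\<open>lim\<close> gives an unspecified value where the sequence diverges; this
    concerns a null set only, and \<open>g\<close> is still measurable.\<close>
  define g where "g x = lim (\<lambda>n. f n x)" for x
  have [measurable]: "g \<in> borel_measurable M" unfolding g_def by measurable
  have bound: "(\<integral>\<^sup>+x. ennreal ((norm (f n x - g x))\<^sup>2) \<partial>M) \<le> ennreal (K * (1/4)^n)" for n
  proof -
    have "AE x in M. ennreal ((norm (f n x - g x))\<^sup>2) = liminf (\<lambda>m. ennreal ((norm (f m x - f n x))\<^sup>2))"
      using conv
    proof eventually_elim
      case (elim x)
      then have "(\<lambda>m. f m x) \<longlonglongrightarrow> g x" by (simp only: g_def convergent_LIMSEQ_iff)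
      then have "(\<lambda>m. ennreal ((norm (f m x - f n x))\<^sup>2)) \<longlonglongrightarrow> ennreal ((norm (g x - f n x))\<^sup>2)"
        by (intro tendsto_intros tendsto_ennrealI)
      from lim_imp_Liminf[OF sequentially_bot this] show ?case
        by (simp add: norm_minus_commute)
    qed
    then have "(\<integral>\<^sup>+x. ennreal ((norm (f n x - g x))\<^sup>2) \<partial>M) =
        (\<integral>\<^sup>+x. liminf (\<lambda>m. ennreal ((norm (f m x - f n x))\<^sup>2)) \<partial>M)"
      by (rule nn_integral_cong_AE)
    also have "\<dots> \<le> liminf (\<lambda>m. \<integral>\<^sup>+x. ennreal ((norm (f m x - f n x))\<^sup>2) \<partial>M)"
      by (rule nn_integral_liminf) measurable
    also have "\<dots> = liminf (\<lambda>m. ennreal (\<integral>x. (norm (f m x - f n x))\<^sup>2 \<partial>M))"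
      by (subst nn_integral_eq_integral[OF int]) auto
    also have "\<dots> \<le> liminf (\<lambda>m. ennreal (K * (1/4)^n))"
      by (intro Liminf_mono eventually_sequentiallyI[of n] ennreal_leI cauchy)
    finally show ?thesis by (simp add: Liminf_const)
  qed
  have int_diff: "integrable M (\<lambda>x. (norm (f n x - g x))\<^sup>2)" for n
    using bound[of n] by (intro integrableI_bounded) (auto simp: order_le_less_trans)
  then have "sq_integrable M (\<lambda>x. f 0 x - g x)" by (simp add: sq_integrable_def)
  from sq_integrable_diff[OF f[of 0] this] have g: "sq_integrable M g" by simp
  have "(\<integral>x. (norm (f n x - g x))\<^sup>2 \<partial>M) \<le> K * (1/4)^n" for n
  proof -
    have "0 \<le> K * (1/4)^n"
      using cauchy[of n n] by simp
    then show ?thesis using bound[of n] nn_integral_eq_integral[OF int_diff[of n]] by simp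
  qed
  moreover have "(\<lambda>n. K * (1/4)^n) \<longlonglongrightarrow> 0"
    by (intro tendsto_mult_right_zero LIMSEQ_realpow_zero) auto
  ultimately have "(\<lambda>n. \<integral>x. (norm (f n x - g x))\<^sup>2 \<partial>M) \<longlonglongrightarrow> 0"
    by (intro Lim_null_comparison[of "\<lambda>n. \<integral>x. (norm (f n x - g x))\<^sup>2 \<partial>M" "\<lambda>n. K * (1/4)^n"]) (simp_all add: eventuallyI)
  with g show thesis by (rule that)
qed

section \<open>Lebesgue integrals of continuous functions\<close>

lemma continuous_lebesgue_measurable:
  fixes f :: "'a::euclidean_space \<Rightarrow> 'b::euclidean_space"
  shows "continuous_on UNIV f \<Longrightarrow> f \<in> borel_measurable lebesgue"
  by (simp add: measurable_completion borel_measurable_continuous_onI)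

lemma integrable_continuous_bounded_support:
  fixes f :: "'a::euclidean_space \<Rightarrow> 'b::euclidean_space"
  assumes "continuous_on UNIV f" "\<And>x. r < norm x \<Longrightarrow> f x = 0"
  shows "integrable lebesgue f"
proof -
  have "integrable lborel (\<lambda>x. indicator (cball 0 r) x *\<^sub>R f x)"
    by (intro borel_integrable_compact continuous_on_subset[OF assms(1)]) auto
  also have "(\<lambda>x. indicator (cball 0 r) x *\<^sub>R f x) = f"
    using assms(2) by (auto simp: indicator_def not_le)
  finally show ?thesis
    using assms(1) by (simp add: integrable_completion borel_measurable_continuous_onI)
qed

lemma integrable_indicator_compact:
  fixes S :: "'a::euclidean_space set"
  assumes "compact S"
  shows "integrable lebesgue (indicator S :: 'a \<Rightarrow> real)"
  using lmeasurable_compact[OF assms] by (intro integrable_real_indicator) (auto simp: fmeasurable_def)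

lemma lebesgue_integral_translate:
  fixes f :: "'a::euclidean_space \<Rightarrow> 'b::euclidean_space"
  assumes "continuous_on UNIV f"
  shows "(\<integral>x. f (c + x) \<partial>lebesgue) = (\<integral>x. f x \<partial>lebesgue)"
proof -
  have m: "f \<in> borel_measurable borel" by (rule borel_measurable_continuous_onI[OF assms])
  have "(\<integral>x. f x \<partial>lborel) = (\<integral>x. f (c + x) \<partial>lborel)"
    by (subst lborel_distr_plus[of c, symmetric]) (simp add: integral_distr m)
  then show ?thesis using m by (simp add: integral_completion)
qed

lemma bounded_continuous_bounded_support:
  fixes f :: "'a::euclidean_space \<Rightarrow> 'b::real_normed_vector"
  assumes "continuous_on UNIV f" "\<And>x. r < norm x \<Longrightarrow> f x = 0"
  obtains B where "0 < B" "\<And>x. norm (f x) \<le> B"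
proof -
  have "compact (f ` cball 0 r)"
    by (rule compact_continuous_image[OF continuous_on_subset[OF assms(1) subset_UNIV] compact_cball])
  then have "bounded (f ` cball 0 r)" by (rule compact_imp_bounded)
  then obtain B where B: "B > 0" "\<And>x. x \<in> cball 0 r \<Longrightarrow> norm (f x) \<le> B"
    unfolding bounded_pos by auto
  have "norm (f x) \<le> B" for x
  proof (cases "norm x \<le> r")
    case True
    then show ?thesis using B(2)[of x] by simp
  next
    case False
    then show ?thesis using B(1) assms(2)[of x] by simp
  qed
  with B(1) show thesis by (rule that)
qed

text \<open>The difference quotients of \<open>\<psi>\<close> in direction \<open>e\<close> integrate to zero by translation
  invariance, and they converge dominatedly.\<close>

lemma integral_directional_derivative_eq_0:
  fixes \<psi> :: "'a::euclidean_space \<Rightarrow> real"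
  assumes D: "\<And>x. (\<psi> has_derivative \<psi>' x) (at x)"
    and cont: "continuous_on UNIV (\<lambda>x. \<psi>' x e)"
    and supp: "\<And>x. r < norm x \<Longrightarrow> \<psi> x = 0"
  shows "(\<integral>x. \<psi>' x e \<partial>lebesgue) = 0"
proof -
  have supp': "\<psi>' x e = 0" if "r < norm x" for x
  proof -
    have "open {x::'a. r < norm x}"
      by (intro open_Collect_less continuous_intros)
    then have "(\<psi> has_derivative (\<lambda>h. 0)) (at x)"
      using that supp by (intro has_derivative_transform_within_open[OF has_derivative_const, of "{x. r < norm x}" x 0 \<psi>]) auto
    then show ?thesis using has_derivative_unique[OF D[of x]] by simp
  qed
  obtain B where B: "0 < B" "\<And>x. norm (\<psi>' x e) \<le> B"
    using bounded_continuous_bounded_support[OF cont supp'] by blast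
  have cont_\<psi>: "continuous_on UNIV \<psi>"
    using D by (intro continuous_at_imp_continuous_on ballI has_derivative_continuous)
  have line: "((\<lambda>s. \<psi> (x + s *\<^sub>R e)) has_real_derivative \<psi>' (x + s *\<^sub>R e) e) (at s)" for x s
  proof -
    have "((\<lambda>s. x + s *\<^sub>R e) has_derivative (\<lambda>h. h *\<^sub>R e)) (at s)"
      by (auto intro!: derivative_eq_intros)
    from has_derivative_compose[OF this D]
    have "((\<lambda>s. \<psi> (x + s *\<^sub>R e)) has_derivative (\<lambda>h. \<psi>' (x + s *\<^sub>R e) (h *\<^sub>R e))) (at s)" .
    also have "(\<lambda>h. \<psi>' (x + s *\<^sub>R e) (h *\<^sub>R e)) = (*) (\<psi>' (x + s *\<^sub>R e) e)"
      using linear_cmul[OF has_derivative_linear[OF D]] by (simp add: fun_eq_iff mult.commute)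
    finally show ?thesis by (simp add: has_field_derivative_def)
  qed
  define t where "t n = 1 / real (Suc n)" for n
  define q where "q n x = (\<psi> (x + t n *\<^sub>R e) - \<psi> x) / t n" for n x
  have t: "0 < t n" "t n \<le> 1" for n by (auto simp: t_def)
  have q_int: "(\<integral>x. q n x \<partial>lebesgue) = 0" for n
  proof -
    have "continuous_on UNIV (\<lambda>x. \<psi> (x + t n *\<^sub>R e))"
      by (intro continuous_on_compose2[OF cont_\<psi>] continuous_intros) auto
    moreover have "\<psi> (x + t n *\<^sub>R e) = 0" if "r + norm (t n *\<^sub>R e) < norm x" for x
      using that norm_triangle_ineq4[of "x + t n *\<^sub>R e" "t n *\<^sub>R e"] by (intro supp) simp
    ultimately have "integrable lebesgue (\<lambda>x. \<psi> (x + t n *\<^sub>R e))"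
      by (rule integrable_continuous_bounded_support)
    moreover have "integrable lebesgue \<psi>"
      by (rule integrable_continuous_bounded_support[OF cont_\<psi> supp])
    ultimately show ?thesis
      using lebesgue_integral_translate[OF cont_\<psi>, of "t n *\<^sub>R e"] by (simp add: q_def add.commute)
  qed
  have "(\<lambda>n. \<integral>x. q n x \<partial>lebesgue) \<longlonglongrightarrow> (\<integral>x. \<psi>' x e \<partial>lebesgue)"
  proof (rule integral_dominated_convergence)
    show "(\<lambda>x. \<psi>' x e) \<in> borel_measurable lebesgue"
      by (rule continuous_lebesgue_measurable[OF cont])
    show "q n \<in> borel_measurable lebesgue" for n
      unfolding q_def
      by (intro continuous_lebesgue_measurable continuous_intros continuous_on_compose2[OF cont_\<psi>]) (use t[of n] in auto)
    \<comment> \<open>The increments \<open>t n\<close> never exceed 1, so every difference quotient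
      vanishes outside the ball of radius \<open>r + norm e\<close>; inside it the mean value
      theorem gives the bound \<open>B\<close>.\<close>
    show "integrable lebesgue (\<lambda>x. B * indicator (cball 0 (r + norm e)) x :: real)"
      by (intro integrable_mult_right integrable_indicator_compact compact_cball)
    show "AE x in lebesgue. (\<lambda>n. q n x) \<longlonglongrightarrow> \<psi>' x e"
    proof (rule AE_I2)
      fix x
      have "((\<lambda>h. (\<psi> (x + h *\<^sub>R e) - \<psi> x) / h) \<longlongrightarrow> \<psi>' x e) (at 0)"
        using line[of x 0] by (simp add: DERIV_def)
      moreover have "filterlim t (at 0) sequentially"
        unfolding filterlim_at t_def using LIMSEQ_Suc[OF lim_1_over_n] by auto
      ultimately show "(\<lambda>n. q n x) \<longlonglongrightarrow> \<psi>' x e"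
        unfolding q_def by (rule filterlim_compose)
    qed
    show "AE x in lebesgue. norm (q n x) \<le> B * indicator (cball 0 (r + norm e)) x" for n
    proof (rule AE_I2)
      fix x
      show "norm (q n x) \<le> B * indicator (cball 0 (r + norm e)) x"
      proof (cases "norm x \<le> r + norm e")
        case True
        obtain s where "\<psi> (x + t n *\<^sub>R e) - \<psi> (x + 0 *\<^sub>R e) = (t n - 0) * \<psi>' (x + s *\<^sub>R e) e"
          using MVT2[OF t(1)[of n] line[of x]] by blast
        then have "q n x = \<psi>' (x + s *\<^sub>R e) e" using t(1)[of n] by (simp add: q_def)
        then show ?thesis using B(2)[of "x + s *\<^sub>R e"] True by simp
      next
        case False
        have "t n * norm e \<le> norm e" using mult_right_mono[OF t(2)[of n], of "norm e"] by simp
        moreover have "norm x \<le> norm (x + t n *\<^sub>R e) + t n * norm e"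
          using norm_triangle_ineq4[of "x + t n *\<^sub>R e" "t n *\<^sub>R e"] t(1)[of n] by simp
        moreover have "0 \<le> norm e" by simp
        ultimately have "r < norm (x + t n *\<^sub>R e)" "r < norm x"
          using False by linarith+
        then show ?thesis using supp B(1) by (simp add: q_def)
      qed
    qed
  qed
  then show ?thesis by (simp add: q_int LIMSEQ_const_iff)
qed

section \<open>Locally integrable functions and weak gradients\<close>

lemma locally_integrable_scaleR:
  fixes f :: "'a::euclidean_space \<Rightarrow> 'b::euclidean_space"
  assumes f: "locally_integrable f" and c: "continuous_on UNIV c"
  shows "locally_integrable (\<lambda>x. c x *\<^sub>R f x)"
  unfolding locally_integrable_def
proof (intro allI impI)
  fix K :: "'a set" assume K: "compact K"
  then have KL: "K \<in> sets lebesgue" by (simp add: lmeasurable_compact fmeasurableD)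
  have "bounded (c ` K)"
    using c K by (intro compact_imp_bounded compact_continuous_image) (auto intro: continuous_on_subset)
  then obtain B where B: "\<And>x. x \<in> K \<Longrightarrow> \<bar>c x\<bar> \<le> B"
    unfolding bounded_iff by auto
  have fK: "integrable (lebesgue_on K) f" using f K by (simp add: locally_integrable_def)
  show "integrable (lebesgue_on K) (\<lambda>x. c x *\<^sub>R f x)"
  proof (rule Bochner_Integration.integrable_bound)
    show "integrable (lebesgue_on K) (\<lambda>x. B *\<^sub>R f x)" using fK by simp
    have "c \<in> borel_measurable (lebesgue_on K)"
      by (intro continuous_imp_measurable_on_sets_lebesgue continuous_on_subset[OF c] KL) auto
    then show "(\<lambda>x. c x *\<^sub>R f x) \<in> borel_measurable (lebesgue_on K)"
      using fK by (intro borel_measurable_scaleR) auto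
    show "AE x in lebesgue_on K. norm (c x *\<^sub>R f x) \<le> norm (B *\<^sub>R f x)"
    proof (rule AE_I2)
      fix x assume "x \<in> space (lebesgue_on K)"
      then have "\<bar>c x\<bar> \<le> \<bar>B\<bar>" using B[of x] by (simp add: space_restrict_space)
      then show "norm (c x *\<^sub>R f x) \<le> norm (B *\<^sub>R f x)" by (simp add: mult_right_mono)
    qed
  qed
qed

lemma locally_integrable_indicator:
  fixes f :: "'a::euclidean_space \<Rightarrow> 'b::euclidean_space"
  assumes "locally_integrable f" "compact K"
  shows "integrable lebesgue (\<lambda>x. indicator K x *\<^sub>R f x)"
proof -
  have "K \<in> sets lebesgue" using assms(2) by (simp add: lmeasurable_compact fmeasurableD)
  then show ?thesis
    using assms integrable_restrict_space[of K lebesgue f] by (simp add: locally_integrable_def)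
qed

lemma integrable_scaleR_bounded_support:
  fixes f :: "'a::euclidean_space \<Rightarrow> 'b::euclidean_space"
  assumes f: "locally_integrable f" and c: "continuous_on UNIV c"
    and supp: "\<And>x. r < norm x \<Longrightarrow> c x = 0"
  shows "integrable lebesgue (\<lambda>x. c x *\<^sub>R f x)"
proof -
  have "integrable lebesgue (\<lambda>x. indicator (cball 0 r) x *\<^sub>R (c x *\<^sub>R f x))"
    by (rule locally_integrable_indicator[OF locally_integrable_scaleR[OF f c] compact_cball])
  also have "(\<lambda>x. indicator (cball 0 r) x *\<^sub>R (c x *\<^sub>R f x)) = (\<lambda>x. c x *\<^sub>R f x)"
    using supp by (auto simp: fun_eq_iff indicator_def simp flip: not_less)
  finally show ?thesis .
qed

lemma integrable_test_mult:
  fixes f :: "real^'n::finite \<Rightarrow> real"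
  assumes "locally_integrable f" "\<phi> \<in> test_functions"
  shows "integrable lebesgue (\<lambda>x. f x * \<phi> x)"
proof -
  obtain r where "\<And>x. r < norm x \<Longrightarrow> \<phi> x = 0" using assms(2) test_functionsE by blast
  from integrable_scaleR_bounded_support[OF assms(1) test_continuous[OF assms(2)] this]
  show ?thesis by (simp add: mult.commute)
qed

lemma sq_integrable_imp_locally_integrable:
  fixes f :: "'a::euclidean_space \<Rightarrow> 'b::euclidean_space"
  assumes "sq_integrable lebesgue f"
  shows "locally_integrable f"
  unfolding locally_integrable_def
proof (intro allI impI)
  fix K :: "'a set" assume K: "compact K"
  then have KL: "K \<in> sets lebesgue" by (simp add: lmeasurable_compact fmeasurableD)
  have "integrable lebesgue (\<lambda>x. indicator K x *\<^sub>R f x)"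
  proof (rule Bochner_Integration.integrable_bound)
    show "integrable lebesgue (\<lambda>x. indicator K x + (norm (f x))\<^sup>2)"
      using assms integrable_indicator_compact[OF K] by (simp add: sq_integrable_def)
    show "(\<lambda>x. indicator K x *\<^sub>R f x) \<in> borel_measurable lebesgue"
      using assms KL by (intro borel_measurable_scaleR borel_measurable_indicator) (auto simp: sq_integrable_def)
    have "norm (f x) \<le> 1 + (norm (f x))\<^sup>2" for x
      using sum_squares_bound[of "norm (f x)" 1] by (simp; smt (verit) norm_ge_zero)
    then show "AE x in lebesgue. norm (indicator K x *\<^sub>R f x) \<le> norm (indicator K x + (norm (f x))\<^sup>2)"
      by (intro AE_I2) (simp add: indicator_def)
  qed
  then show "integrable (lebesgue_on K) f"
    using KL by (simp add: integrable_restrict_space)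
qed

lemma locally_integrable_diff:
  fixes f g :: "'a::euclidean_space \<Rightarrow> 'b::euclidean_space"
  assumes "locally_integrable f" "locally_integrable g"
  shows "locally_integrable (\<lambda>x. f x - g x)"
  using assms by (simp add: locally_integrable_def)

lemma locally_integrable_component:
  fixes g :: "'a::euclidean_space \<Rightarrow> real^'n::finite"
  assumes "locally_integrable g"
  shows "locally_integrable (\<lambda>x. g x $ i)"
  using assms unfolding locally_integrable_def
  by (auto intro: integrable_bounded_linear[OF bounded_linear_vec_nth])

lemma locally_integrable_measurable:
  fixes f :: "'a::euclidean_space \<Rightarrow> 'b::euclidean_space"
  assumes "locally_integrable f"
  shows "f \<in> borel_measurable lebesgue"
proof (rule borel_measurable_LIMSEQ_metric)
  show "(\<lambda>x. indicator (cball 0 (real n)) x *\<^sub>R f x) \<in> borel_measurable lebesgue" for n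
    using locally_integrable_indicator[OF assms compact_cball] by (rule borel_measurable_integrable)
  show "(\<lambda>n. indicator (cball 0 (real n)) x *\<^sub>R f x) \<longlonglongrightarrow> f x" for x
  proof (rule tendsto_eventually)
    obtain m :: nat where "norm x \<le> real m" using real_arch_simple by blast
    then show "\<forall>\<^sub>F n in sequentially. indicator (cball 0 (real n)) x *\<^sub>R f x = f x"
      by (intro eventually_sequentiallyI[of m]) (auto simp: indicator_def)
  qed
qed

section \<open>From test functions to integrals over boxes\<close>

lemma locally_integrable_integrable_on:
  fixes f :: "'a::euclidean_space \<Rightarrow> 'b::euclidean_space"
  assumes "locally_integrable f"
  shows "f integrable_on cbox a b"
  using assms has_integral_integral_lebesgue_on[of "cbox a b" f]
  by (auto simp: locally_integrable_def)

text \<open>The bridge from pairings with test functions to integrals over boxes. The absolute value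
  of \<open>f\<close> on the closed box dominates; the bumps tend to the indicator of the open box,
  and the faces contribute nothing.\<close>

lemma box_bump_integral_tendsto:
  fixes f :: "real^'n::finite \<Rightarrow> real"
  assumes f: "locally_integrable f"
  shows "(\<lambda>n. \<integral>x. f x * box_bump a b n x \<partial>lebesgue) \<longlonglongrightarrow> integral (cbox a b) f"
proof -
  have int: "integrable lebesgue (\<lambda>x. indicator (cbox a b) x *\<^sub>R f x)"
    by (rule locally_integrable_indicator[OF f compact_cbox])
  have meas: "f \<in> borel_measurable lebesgue" by (rule locally_integrable_measurable[OF f])
  have "(\<lambda>n. \<integral>x. f x * box_bump a b n x \<partial>lebesgue) \<longlonglongrightarrow> (\<integral>x. f x * indicator (box a b) x \<partial>lebesgue)"
  proof (rule integral_dominated_convergence)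
    show "(\<lambda>x. f x * indicator (box a b) x) \<in> borel_measurable lebesgue"
      using meas by (intro borel_measurable_times borel_measurable_indicator) auto
    show "(\<lambda>x. f x * box_bump a b n x) \<in> borel_measurable lebesgue" for n
      using integrable_test_mult[OF f box_bump_test] by (rule borel_measurable_integrable)
    show "integrable lebesgue (\<lambda>x. norm (indicator (cbox a b) x *\<^sub>R f x))"
      using int by (rule integrable_norm)
    show "AE x in lebesgue. (\<lambda>n. f x * box_bump a b n x) \<longlonglongrightarrow> f x * indicator (box a b) x"
      by (intro AE_I2 tendsto_intros box_bump_tendsto)
    show "AE x in lebesgue. norm (f x * box_bump a b n x) \<le> norm (indicator (cbox a b) x *\<^sub>R f x)" for n
    proof (rule AE_I2)
      fix x
      show "norm (f x * box_bump a b n x) \<le> norm (indicator (cbox a b) x *\<^sub>R f x)"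
      proof (cases "x \<in> box a b")
        case True
        then show ?thesis
          using mult_left_le[OF box_bump_bounds(2), of "\<bar>f x\<bar>" a b n x] box_bump_bounds(1)[of a b n x] box_subset_cbox[of a b]
          by (auto simp: abs_mult)
      qed (simp add: box_bump_eq_0)
    qed
  qed
  also have "(\<integral>x. f x * indicator (box a b) x \<partial>lebesgue) = integral (box a b) f"
  proof -
    have "set_integrable lebesgue (box a b) f"
    proof -
      have "set_integrable lebesgue (cbox a b) f" using int by (simp add: set_integrable_def)
      then show ?thesis by (rule set_integrable_subset) (auto simp: box_subset_cbox)
    qed
    from set_lebesgue_integral_eq_integral(2)[OF this] show ?thesis
      by (simp add: set_lebesgue_integral_def mult.commute)
  qed
  finally show ?thesis by (simp add: integral_open_interval)
qed

text \<open>Cubes with a corner at the point suit the use below: the translation from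
  \<open>x\<close> to \<open>y\<close> carries the cube at \<open>x\<close> onto the cube of the
  same side at \<open>y\<close>.\<close>

lemma Lebesgue_differentiation_cube:
  fixes f :: "real^'n::finite \<Rightarrow> real"
  assumes "locally_integrable f"
  obtains N where "negligible N"
    "\<And>x. x \<notin> N \<Longrightarrow> ((\<lambda>h. integral (cbox x (x + h *\<^sub>R One)) f / h ^ CARD('n)) \<longlongrightarrow> f x) (at_right 0)"
proof -
  obtain N where N: "negligible N" and
    lim: "\<And>x e. \<lbrakk>x \<notin> N; 0 < e\<rbrakk> \<Longrightarrow> \<exists>d>0. \<forall>h. 0 < h \<and> h < d \<longrightarrow>
       norm (integral (cbox x (x + h *\<^sub>R One)) f /\<^sub>R h ^ DIM(real^'n) - f x) < e"
    using integrable_ccontinuous_explicit[OF locally_integrable_integrable_on[OF assms]] by metis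
  have "((\<lambda>h. integral (cbox x (x + h *\<^sub>R One)) f / h ^ CARD('n)) \<longlongrightarrow> f x) (at_right 0)" if "x \<notin> N" for x
    unfolding tendsto_iff
  proof (intro allI impI)
    fix e :: real assume "0 < e"
    from lim[OF that this] show "\<forall>\<^sub>F h in at_right 0. dist (integral (cbox x (x + h *\<^sub>R One)) f / h ^ CARD('n)) (f x) < e"
      by (auto simp: eventually_at_right_field dist_norm divide_inverse mult.commute)
  qed
  with N show thesis by (rule that)
qed

lemma AE_lebesgue_negligible:
  "negligible N \<Longrightarrow> (\<And>x. x \<notin> N \<Longrightarrow> P x) \<Longrightarrow> AE x in lebesgue. P x"
  by (rule AE_I'[of N]) (auto simp: negligible_iff_null_sets)

text \<open>Testing with bumps kills all box integrals, and \<open>f\<close> is recovered almost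
  everywhere by averaging over shrinking cubes.\<close>

theorem fundamental_lemma:
  fixes f :: "real^'n::finite \<Rightarrow> real"
  assumes f: "locally_integrable f"
    and 0: "\<And>\<phi>. \<phi> \<in> test_functions \<Longrightarrow> (\<integral>x. f x * \<phi> x \<partial>lebesgue) = 0"
  shows "AE x in lebesgue. f x = 0"
proof -
  have box: "integral (cbox a b) f = 0" for a b
    using box_bump_integral_tendsto[OF f, of a b] by (simp add: 0 box_bump_test LIMSEQ_const_iff)
  obtain N where N: "negligible N" and
    lim: "\<And>x. x \<notin> N \<Longrightarrow> ((\<lambda>h. integral (cbox x (x + h *\<^sub>R One)) f / h ^ CARD('n)) \<longlongrightarrow> f x) (at_right 0)"
    by (rule Lebesgue_differentiation_cube[OF f]) (rule that)
  show ?thesis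
  proof (rule AE_lebesgue_negligible[OF N])
    show "f x = 0" if "x \<notin> N" for x
      using tendsto_unique[OF trivial_limit_at_right_real lim[OF that], of 0] by (simp add: box)
  qed
qed

text \<open>Invariance applied to bumps makes box integrals unchanged under translation of the box.
  The averages at two Lebesgue points are then equal, so \<open>f\<close> agrees almost everywhere
  with its value at one such point.\<close>

theorem translation_invariant_AE_const:
  fixes f :: "real^'n::finite \<Rightarrow> real"
  assumes f: "locally_integrable f"
    and inv: "\<And>\<phi> h. \<phi> \<in> test_functions \<Longrightarrow> (\<integral>x. f x * \<phi> (x + h) \<partial>lebesgue) = (\<integral>x. f x * \<phi> x \<partial>lebesgue)"
  obtains c where "AE x in lebesgue. f x = c"
proof -
  have box: "integral (cbox (a + c) (b + c)) f = integral (cbox a b) f" for a b c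
  proof -
    have "(\<integral>x. f x * box_bump (a + c) (b + c) n x \<partial>lebesgue) = (\<integral>x. f x * box_bump a b n x \<partial>lebesgue)" for n
    proof -
      have "box_bump (a + c) (b + c) n x = box_bump a b n (x + - c)" for x
        using box_bump_translate[of a c b n "x - c"] by simp
      then show ?thesis using inv[OF box_bump_test, of a b n "- c"] by simp
    qed
    with box_bump_integral_tendsto[OF f, of "a + c" "b + c"] box_bump_integral_tendsto[OF f, of a b]
    show ?thesis by (simp add: LIMSEQ_unique)
  qed
  obtain N where N: "negligible N" and
    lim: "\<And>x. x \<notin> N \<Longrightarrow> ((\<lambda>h. integral (cbox x (x + h *\<^sub>R One)) f / h ^ CARD('n)) \<longlongrightarrow> f x) (at_right 0)"
    by (rule Lebesgue_differentiation_cube[OF f]) (rule that)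
  have "N \<noteq> UNIV" using N non_negligible_UNIV by blast
  then obtain y where y: "y \<notin> N" by blast
  have "AE x in lebesgue. f x = f y"
  proof (rule AE_lebesgue_negligible[OF N])
    fix x assume "x \<notin> N"
    have "integral (cbox x (x + h *\<^sub>R One)) f = integral (cbox y (y + h *\<^sub>R One)) f" for h
    proof -
      have "y + (x - y) = x" "y + h *\<^sub>R One + (x - y) = x + h *\<^sub>R One" by auto
      then show ?thesis using box[of y "x - y" "y + h *\<^sub>R One"] by metis
    qed
    with lim[OF \<open>x \<notin> N\<close>] have "((\<lambda>h. integral (cbox y (y + h *\<^sub>R One)) f / h ^ CARD('n)) \<longlongrightarrow> f x) (at_right 0)"
      by simp
    then show "f x = f y" using lim[OF y] by (rule tendsto_unique[rotated]) simp
  qed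
  then show thesis by (rule that)
qed

section \<open>Weak gradients\<close>

lemma has_weak_gradient_iff:
  "has_weak_gradient v g \<longleftrightarrow> locally_integrable v \<and> locally_integrable g \<and>
    (\<forall>i. \<forall>\<phi>\<in>test_functions. (\<integral>x. v x * part_deriv i \<phi> x \<partial>lebesgue) = - (\<integral>x. g x $ i * \<phi> x \<partial>lebesgue))"
  unfolding has_weak_gradient_def distr_eq_def distr_deriv_def regular_distr_def
  by (auto simp: minus_equation_iff eq_commute)

lemma has_weak_gradient_diff:
  assumes "has_weak_gradient v g" "has_weak_gradient w h"
  shows "has_weak_gradient (\<lambda>x. v x - w x) (\<lambda>x. g x - h x)"
  using assms unfolding has_weak_gradient_iff
  by (simp add: locally_integrable_diff left_diff_distrib integrable_test_mult test_part_deriv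
      locally_integrable_component)

lemma weak_gradient_AE_0:
  assumes v: "has_weak_gradient v g" and 0: "AE x in lebesgue. v x = 0"
  shows "AE x in lebesgue. g x = 0"
proof -
  have "AE x in lebesgue. g x $ i = 0" for i
  proof (rule fundamental_lemma)
    show "locally_integrable (\<lambda>x. g x $ i)"
      using v by (simp add: has_weak_gradient_iff locally_integrable_component)
    fix \<phi> :: "real^'a \<Rightarrow> real" assume \<phi>: "\<phi> \<in> test_functions"
    have "(\<integral>x. v x * part_deriv i \<phi> x \<partial>lebesgue) = 0"
      using 0 by (intro integral_eq_zero_AE) auto
    then show "(\<integral>x. g x $ i * \<phi> x \<partial>lebesgue) = 0"
      using v \<phi> by (simp add: has_weak_gradient_iff)
  qed
  then have "AE x in lebesgue. \<forall>i. g x $ i = 0" by (simp add: AE_all_countable)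
  then show ?thesis by eventually_elim (simp add: vec_eq_iff)
qed

lemma weak_gradient_unique:
  assumes "has_weak_gradient v g" "has_weak_gradient v h"
  shows "AE x in lebesgue. g x = h x"
  using weak_gradient_AE_0[OF has_weak_gradient_diff[OF assms]] by simp

lemma weak_grad_AE_eq:
  assumes "has_weak_gradient v g"
  shows "AE x in lebesgue. weak_grad v x = g x"
  using weak_gradient_unique[OF someI[of "has_weak_gradient v"]] assms by (simp add: weak_grad_def)

lemma continuous_locally_integrable:
  fixes f :: "'a::euclidean_space \<Rightarrow> 'b::euclidean_space"
  assumes "continuous_on UNIV f"
  shows "locally_integrable f"
  unfolding locally_integrable_def
proof (intro allI impI)
  fix K :: "'a set" assume K: "compact K"
  then have KL: "K \<in> sets lebesgue" by (simp add: lmeasurable_compact fmeasurableD)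
  have "integrable lborel (\<lambda>x. indicator K x *\<^sub>R f x)"
    by (intro borel_integrable_compact continuous_on_subset[OF assms] K) auto
  moreover have "(\<lambda>x. indicator K x *\<^sub>R f x) \<in> borel_measurable lborel"
    using K assms by (intro borel_measurable_scaleR borel_measurable_indicator)
      (auto simp: borel_compact borel_measurable_continuous_onI)
  ultimately show "integrable (lebesgue_on K) f"
    using KL by (simp add: integrable_restrict_space integrable_completion)
qed

lemma test_has_weak_gradient:
  assumes \<phi>: "\<phi> \<in> test_functions"
  shows "has_weak_gradient \<phi> (grad \<phi>)"
  unfolding has_weak_gradient_iff
proof (intro conjI allI ballI)
  show "locally_integrable \<phi>" "locally_integrable (grad \<phi>)"
    using test_continuous[OF \<phi>] test_grad_continuous[OF \<phi>] by (auto intro: continuous_locally_integrable)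
  fix i and \<psi> :: "real^'a \<Rightarrow> real" assume \<psi>: "\<psi> \<in> test_functions"
  obtain r where r: "\<And>x. r < norm x \<Longrightarrow> \<phi> x = 0" using \<phi> test_functionsE by blast
  \<comment> \<open>The integrand is the derivative of \<open>\<phi> x * \<psi> x\<close> in
    direction \<open>axis i 1\<close>: integration by parts without a boundary term, since
    \<open>\<phi>\<close> has bounded support.\<close>
  have "(\<integral>x. \<phi> x * (grad \<psi> x \<bullet> axis i 1) + (grad \<phi> x \<bullet> axis i 1) * \<psi> x \<partial>lebesgue) = 0"
  proof (rule integral_directional_derivative_eq_0)
    show "((\<lambda>x. \<phi> x * \<psi> x) has_derivative (\<lambda>h. \<phi> x * (grad \<psi> x \<bullet> h) + (grad \<phi> x \<bullet> h) * \<psi> x)) (at x)" for x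
      by (rule has_derivative_mult[OF test_has_derivative[OF \<phi>] test_has_derivative[OF \<psi>]])
    show "continuous_on UNIV (\<lambda>x. \<phi> x * (grad \<psi> x \<bullet> axis i 1) + (grad \<phi> x \<bullet> axis i 1) * \<psi> x)"
      by (intro continuous_intros test_continuous test_grad_continuous \<phi> \<psi>)
    show "\<phi> x * \<psi> x = 0" if "r < norm x" for x using r that by simp
  qed
  then have "(\<integral>x. \<phi> x * part_deriv i \<psi> x + part_deriv i \<phi> x * \<psi> x \<partial>lebesgue) = 0"
    by (simp add: inner_axis grad_def)
  moreover have "integrable lebesgue (\<lambda>x. \<phi> x * part_deriv i \<psi> x)" "integrable lebesgue (\<lambda>x. part_deriv i \<phi> x * \<psi> x)"
    by (auto intro!: integrable_test_mult continuous_locally_integrable test_continuous test_part_deriv \<phi> \<psi>)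
  ultimately show "(\<integral>x. \<phi> x * part_deriv i \<psi> x \<partial>lebesgue) = - (\<integral>x. grad \<phi> x $ i * \<psi> x \<partial>lebesgue)"
    by (simp add: grad_def)
qed

lemma test_grad_support:
  assumes "\<phi> \<in> test_functions"
  obtains r where "\<And>x. r < norm x \<Longrightarrow> grad \<phi> x = 0"
proof -
  have "\<exists>r. \<forall>x. r < norm x \<longrightarrow> part_deriv i \<phi> x = 0" for i
    using test_functionsE[OF test_part_deriv[OF assms, of i]] by metis
  then obtain r where r: "\<And>i x. r i < norm x \<Longrightarrow> part_deriv i \<phi> x = 0" by metis
  have "grad \<phi> x = 0" if "Max (range r) < norm x" for x
    using that by (auto simp: grad_def vec_eq_iff intro!: r)
  then show thesis by (rule that)
qed

lemma sq_integrable_continuous_bounded_support: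
  fixes f :: "'a::euclidean_space \<Rightarrow> 'b::euclidean_space"
  assumes "continuous_on UNIV f" "\<And>x. r < norm x \<Longrightarrow> f x = 0"
  shows "sq_integrable lebesgue f"
  unfolding sq_integrable_def
  using assms by (auto intro!: continuous_lebesgue_measurable integrable_continuous_bounded_support[where r = r] continuous_intros)

lemma test_grad_sq_integrable:
  assumes "\<phi> \<in> test_functions"
  shows "sq_integrable lebesgue (grad \<phi>)"
  using test_grad_support[OF assms] sq_integrable_continuous_bounded_support[OF test_grad_continuous[OF assms]] by metis

section \<open>Mollification and the Liouville property\<close>

lemma test_line_derivative:
  assumes "\<phi> \<in> test_functions"
  shows "((\<lambda>s. \<phi> (p + s *\<^sub>R h)) has_real_derivative grad \<phi> (p + s *\<^sub>R h) \<bullet> h) (at s)"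
proof -
  have "((\<lambda>s. p + s *\<^sub>R h) has_derivative (\<lambda>t. t *\<^sub>R h)) (at s)"
    by (auto intro!: derivative_eq_intros)
  from has_derivative_compose[OF this test_has_derivative[OF assms]]
  have "((\<lambda>s. \<phi> (p + s *\<^sub>R h)) has_derivative (\<lambda>t. grad \<phi> (p + s *\<^sub>R h) \<bullet> (t *\<^sub>R h))) (at s)" .
  moreover have "(\<lambda>t. grad \<phi> (p + s *\<^sub>R h) \<bullet> (t *\<^sub>R h)) = (*) (grad \<phi> (p + s *\<^sub>R h) \<bullet> h)"
    by (simp add: fun_eq_iff mult.commute)
  ultimately show ?thesis by (simp add: has_field_derivative_def)
qed

lemma test_mean_value:
  assumes "\<phi> \<in> test_functions"
  obtains s where "0 < s" "s < 1" "\<phi> (p + h) - \<phi> p = grad \<phi> (p + s *\<^sub>R h) \<bullet> h"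
proof -
  obtain s where "0 < s" "s < 1" "\<phi> (p + 1 *\<^sub>R h) - \<phi> (p + 0 *\<^sub>R h) = (1 - 0) * (grad \<phi> (p + s *\<^sub>R h) \<bullet> h)"
    using MVT2[of 0 1, OF zero_less_one test_line_derivative[OF assms, of p h]] by blast
  then show thesis using that by simp
qed

lemma test_lipschitz:
  assumes "\<phi> \<in> test_functions"
  obtains L where "0 < L" "\<And>p h. \<bar>\<phi> (p + h) - \<phi> p\<bar> \<le> L * norm h"
proof -
  obtain r where r: "\<And>x. r < norm x \<Longrightarrow> grad \<phi> x = 0" using test_grad_support[OF assms] by blast
  obtain B where B: "0 < B" "\<And>x. norm (grad \<phi> x) \<le> B"
    using bounded_continuous_bounded_support[OF test_grad_continuous[OF assms] r] by blast
  have "\<bar>\<phi> (p + h) - \<phi> p\<bar> \<le> B * norm h" for p h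
  proof -
    obtain s where "\<phi> (p + h) - \<phi> p = grad \<phi> (p + s *\<^sub>R h) \<bullet> h"
      using test_mean_value[OF assms] by blast
    then have "\<bar>\<phi> (p + h) - \<phi> p\<bar> \<le> norm (grad \<phi> (p + s *\<^sub>R h)) * norm h"
      by (simp add: Cauchy_Schwarz_ineq2)
    also have "\<dots> \<le> B * norm h" by (intro mult_right_mono B) auto
    finally show ?thesis .
  qed
  with B(1) show thesis by (rule that)
qed

text \<open>The constant is uniform in \<open>p\<close> and \<open>h\<close>, as differentiation
  under the convolution integral demands. It is the sum of the Lipschitz constants of the partial
  derivatives; the mean value theorem forgoes the usual factor 1/2.\<close>

lemma test_taylor:
  assumes \<phi>: "\<phi> \<in> test_functions"
  obtains C where "0 < C" "\<And>p h. \<bar>\<phi> (p + h) - \<phi> p - grad \<phi> p \<bullet> h\<bar> \<le> C * (norm h)\<^sup>2"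
proof -
  have "\<exists>L>0. \<forall>p h. \<bar>part_deriv i \<phi> (p + h) - part_deriv i \<phi> p\<bar> \<le> L * norm h" for i
    using test_lipschitz[OF test_part_deriv[OF \<phi>, of i]] by metis
  then obtain L where L: "\<And>i. 0 < L i" "\<And>i p h. \<bar>part_deriv i \<phi> (p + h) - part_deriv i \<phi> p\<bar> \<le> L i * norm h"
    by metis
  define C where "C = sum L UNIV"
  have "0 < C" unfolding C_def by (intro sum_pos L) auto
  have lip: "norm (grad \<phi> (p + h) - grad \<phi> p) \<le> C * norm h" for p h
  proof -
    have "norm (grad \<phi> (p + h) - grad \<phi> p) \<le> (\<Sum>i\<in>UNIV. \<bar>(grad \<phi> (p + h) - grad \<phi> p) $ i\<bar>)"
      by (rule norm_le_l1_cart)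
    also have "\<dots> \<le> (\<Sum>i\<in>UNIV. L i * norm h)"
      by (intro sum_mono) (simp add: grad_def L)
    finally show ?thesis by (simp add: C_def sum_distrib_right)
  qed
  have "\<bar>\<phi> (p + h) - \<phi> p - grad \<phi> p \<bullet> h\<bar> \<le> C * (norm h)\<^sup>2" for p h
  proof -
    obtain s where s: "0 < s" "s < 1" "\<phi> (p + h) - \<phi> p = grad \<phi> (p + s *\<^sub>R h) \<bullet> h"
      using test_mean_value[OF \<phi>] by blast
    have "\<phi> (p + h) - \<phi> p - grad \<phi> p \<bullet> h = (grad \<phi> (p + s *\<^sub>R h) - grad \<phi> p) \<bullet> h"
      using s(3) by (simp add: inner_diff_left)
    then have "\<bar>\<phi> (p + h) - \<phi> p - grad \<phi> p \<bullet> h\<bar> \<le> norm (grad \<phi> (p + s *\<^sub>R h) - grad \<phi> p) * norm h"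
      by (simp add: Cauchy_Schwarz_ineq2)
    also have "\<dots> \<le> (C * norm (s *\<^sub>R h)) * norm h" by (intro mult_right_mono lip) auto
    also have "\<dots> \<le> (C * norm h) * norm h"
      using s \<open>0 < C\<close> mult_right_mono[of s 1 "norm h"] by (intro mult_right_mono mult_left_mono) auto
    finally show ?thesis by (simp add: power2_eq_square)
  qed
  with \<open>0 < C\<close> show thesis by (rule that)
qed

section \<open>Convolution with test functions\<close>

definition conv :: "(real^'n::finite \<Rightarrow> real) \<Rightarrow> (real^'n \<Rightarrow> real) \<Rightarrow> real^'n \<Rightarrow> real" where
  "conv f \<phi> x = (\<integral>y. f y * \<phi> (x - y) \<partial>lebesgue)"

lemma test_reflect:
  assumes "\<phi> \<in> test_functions"
  shows "(\<lambda>y. \<phi> (x - y)) \<in> test_functions"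
  using test_affine[OF assms, of "-1" x] by simp

lemma part_deriv_reflect:
  assumes "\<phi> \<in> test_functions"
  shows "part_deriv i (\<lambda>y. \<phi> (x - y)) y = - part_deriv i \<phi> (x - y)"
  using part_deriv_affine[OF assms, of i "-1" x] by (simp add: fun_eq_iff)

lemma conv_integrable:
  "locally_integrable f \<Longrightarrow> \<phi> \<in> test_functions \<Longrightarrow> integrable lebesgue (\<lambda>y. f y * \<phi> (x - y))"
  by (rule integrable_test_mult[OF _ test_reflect])

text \<open>All derivatives fall on \<open>\<phi>\<close>, so local integrability of
  \<open>f\<close> is enough: the increment minus its linear part is the integral of
  \<open>f\<close> against a Taylor remainder of size \<open>C * (norm h)\<^sup>2\<close> that lives
  in a fixed ball.\<close>

lemma conv_has_derivative:
  fixes f :: "real^'n::finite \<Rightarrow> real"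
  assumes f: "locally_integrable f" and \<phi>: "\<phi> \<in> test_functions"
  shows "(conv f \<phi> has_derivative (\<lambda>h. (\<chi> i. conv f (part_deriv i \<phi>) x) \<bullet> h)) (at x)"
proof -
  let ?D = "\<lambda>h. (\<chi> i. conv f (part_deriv i \<phi>) x) \<bullet> h"
  obtain C where C: "0 < C" "\<And>p h. \<bar>\<phi> (p + h) - \<phi> p - grad \<phi> p \<bullet> h\<bar> \<le> C * (norm h)\<^sup>2"
    using test_taylor[OF \<phi>] by blast
  obtain r where r: "\<And>x. r < norm x \<Longrightarrow> \<phi> x = 0" using \<phi> test_functionsE by blast
  obtain r' where r': "\<And>x. r' < norm x \<Longrightarrow> grad \<phi> x = 0" using test_grad_support[OF \<phi>] by blast
  \<comment> \<open>The summand 1 allows for \<open>norm h \<le> 1\<close>: if \<open>norm y\<close>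
    exceeds \<open>R\<close>, then \<open>x - y\<close> and \<open>x + h - y\<close> both lie
    outside the supports of \<open>\<phi>\<close> and \<open>grad \<phi>\<close>.\<close>
  define R where "R = norm x + 1 + max r r'"
  define I where "I = (\<integral>y. indicator (cball 0 R) y *\<^sub>R \<bar>f y\<bar> \<partial>lebesgue)"
  have int_D: "integrable lebesgue (\<lambda>y. f y * (grad \<phi> (x - y) \<bullet> h))"
    and D: "?D h = (\<integral>y. f y * (grad \<phi> (x - y) \<bullet> h) \<partial>lebesgue)" for h
  proof -
    have eq: "f y * (grad \<phi> (x - y) \<bullet> h) = (\<Sum>i\<in>UNIV. f y * part_deriv i \<phi> (x - y) * h $ i)" for y
      by (simp add: grad_def inner_vec_def sum_distrib_left mult.assoc)
    show "integrable lebesgue (\<lambda>y. f y * (grad \<phi> (x - y) \<bullet> h))"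
      unfolding eq by (intro Bochner_Integration.integrable_sum integrable_mult_left conv_integrable f test_part_deriv \<phi>)
    have "(\<integral>y. f y * (grad \<phi> (x - y) \<bullet> h) \<partial>lebesgue) =
        (\<Sum>i\<in>UNIV. \<integral>y. f y * part_deriv i \<phi> (x - y) * h $ i \<partial>lebesgue)"
      unfolding eq
      by (intro Bochner_Integration.integral_sum integrable_mult_left conv_integrable f test_part_deriv \<phi>)
    also have "\<dots> = ?D h" by (simp add: inner_vec_def conv_def)
    finally show "?D h = (\<integral>y. f y * (grad \<phi> (x - y) \<bullet> h) \<partial>lebesgue)" ..
  qed
  have bound: "\<bar>conv f \<phi> (x + h) - conv f \<phi> x - ?D h\<bar> \<le> C * I * (norm h)\<^sup>2" if h: "norm h \<le> 1" for h
  proof -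
    let ?e = "\<lambda>y. \<phi> (x + h - y) - \<phi> (x - y) - grad \<phi> (x - y) \<bullet> h"
    have int_e: "integrable lebesgue (\<lambda>y. f y * ?e y)"
      unfolding right_diff_distrib
      by (intro Bochner_Integration.integrable_diff conv_integrable f \<phi> int_D)
    have diff: "conv f \<phi> (x + h) - conv f \<phi> x - ?D h = (\<integral>y. f y * ?e y \<partial>lebesgue)"
      unfolding D right_diff_distrib
      by (simp add: conv_def Bochner_Integration.integral_diff Bochner_Integration.integrable_diff conv_integrable f \<phi> int_D)
    have "\<bar>conv f \<phi> (x + h) - conv f \<phi> x - ?D h\<bar> \<le> (\<integral>y. \<bar>f y * ?e y\<bar> \<partial>lebesgue)"
      unfolding diff by (rule integral_abs_bound)
    also have "\<dots> \<le> (\<integral>y. C * (norm h)\<^sup>2 * (indicator (cball 0 R) y *\<^sub>R \<bar>f y\<bar>) \<partial>lebesgue)"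
    proof (rule integral_mono)
      show "integrable lebesgue (\<lambda>y. \<bar>f y * ?e y\<bar>)" using int_e by (rule integrable_abs)
      have "integrable lebesgue (\<lambda>y. \<bar>indicator (cball 0 R) y *\<^sub>R f y\<bar>)"
        by (intro integrable_abs locally_integrable_indicator f compact_cball)
      then show "integrable lebesgue (\<lambda>y. C * (norm h)\<^sup>2 * (indicator (cball 0 R) y *\<^sub>R \<bar>f y\<bar>))"
        by (simp add: abs_mult)
      fix y
      show "\<bar>f y * ?e y\<bar> \<le> C * (norm h)\<^sup>2 * (indicator (cball 0 R) y *\<^sub>R \<bar>f y\<bar>)"
      proof (cases "norm y \<le> R")
        case True
        have "\<bar>?e y\<bar> \<le> C * (norm h)\<^sup>2" using C(2)[of "x - y" h] by (simp add: algebra_simps)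
        then show ?thesis using True mult_left_mono[OF _ abs_ge_zero[of "f y"]]
          by (simp add: abs_mult mult.commute[of "C * (norm h)\<^sup>2"])
      next
        case False
        have "norm y \<le> norm (x - y) + norm x" "norm y \<le> norm (x + h - y) + norm (x + h)"
          using norm_triangle_ineq4[of x "x - y"] norm_triangle_ineq4[of "x + h" "x + h - y"] by auto
        moreover have "norm (x + h) \<le> norm x + 1" using norm_triangle_ineq[of x h] h by simp
        ultimately have "max r r' < norm (x - y)" "max r r' < norm (x + h - y)"
          using False unfolding R_def by linarith+
        then show ?thesis using r r' C(1) by simp
      qed
    qed
    also have "\<dots> = C * I * (norm h)\<^sup>2" by (simp add: I_def)
    finally show ?thesis .
  qed
  show ?thesis
    unfolding has_derivative_iff_norm
  proof (intro conjI bounded_linear_inner_right)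
    show "((\<lambda>y. norm (conv f \<phi> y - conv f \<phi> x - ?D (y - x)) / norm (y - x)) \<longlongrightarrow> 0) (at x)"
    proof (rule Lim_null_comparison)
      have "((\<lambda>y. C * I * norm (y - x)) \<longlongrightarrow> C * I * norm (x - x)) (at x)"
        by (intro tendsto_intros)
      then show "((\<lambda>y. C * I * norm (y - x)) \<longlongrightarrow> 0) (at x)" by simp
      have "norm (norm (conv f \<phi> y - conv f \<phi> x - ?D (y - x)) / norm (y - x)) \<le> C * I * norm (y - x)"
        if "y \<noteq> x" "dist y x < 1" for y
        using bound[of "y - x"] that by (simp add: dist_norm divide_le_eq power2_eq_square)
      then show "\<forall>\<^sub>F y in at x. norm (norm (conv f \<phi> y - conv f \<phi> x - ?D (y - x)) / norm (y - x)) \<le> C * I * norm (y - x)"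
        unfolding eventually_at by (intro exI[of _ 1]) auto
    qed
  qed
qed

text \<open>The reflection in \<open>\<phi> (x - y)\<close> contributes a minus sign, which cancels
  the one in the definition of the weak derivative.\<close>

lemma conv_weak_gradient:
  assumes f: "has_weak_gradient f g" and \<phi>: "\<phi> \<in> test_functions"
  shows "conv f (part_deriv i \<phi>) x = conv (\<lambda>y. g y $ i) \<phi> x"
proof -
  have "(\<integral>y. f y * part_deriv i (\<lambda>y. \<phi> (x - y)) y \<partial>lebesgue) = - (\<integral>y. g y $ i * \<phi> (x - y) \<partial>lebesgue)"
    using f test_reflect[OF \<phi>] unfolding has_weak_gradient_iff by blast
  then show ?thesis by (simp add: part_deriv_reflect[OF \<phi>] conv_def)
qed

section \<open>Maximum principle for harmonic functions vanishing at infinity\<close>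

lemma second_derivative_local_max:
  fixes f f' :: "real \<Rightarrow> real"
  assumes f: "\<And>t. (f has_real_derivative f' t) (at t)" and f': "(f' has_real_derivative l) (at 0)"
    and max: "0 < d" "\<And>t. \<bar>t\<bar> < d \<Longrightarrow> f t \<le> f 0"
  shows "l \<le> 0"
proof (rule ccontr)
  assume "\<not> l \<le> 0"
  \<comment> \<open>A positive second derivative makes \<open>f'\<close> exceed
    \<open>f' 0 = 0\<close> just to the right of 0, and the mean value theorem then lifts
    \<open>f\<close> above its maximum.\<close>
  then obtain e where e: "0 < e" "\<And>h. 0 < h \<Longrightarrow> h < e \<Longrightarrow> f' 0 < f' (0 + h)"
    using DERIV_pos_inc_right[OF f'] by force
  have "f' 0 = 0"
    using DERIV_local_max[OF f max(1)] max(2) by simp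
  define t where "t = min d e / 2"
  have t: "0 < t" "t < d" "t < e" using max(1) e(1) by (auto simp: t_def min_def)
  obtain s where s: "0 < s" "s < t" "f t - f 0 = (t - 0) * f' s"
    using MVT2[OF t(1) f] by blast
  have "0 < f' s" using e(2)[of s] s t \<open>f' 0 = 0\<close> by simp
  then have "0 < f t - f 0" using s t by simp
  then show False using max(2)[of t] t by simp
qed

text \<open>For a positive value of \<open>h\<close>, the function \<open>h + \<delta> |x|\<^sup>2\<close> would have an interior maximum on a
  large ball, although its Laplacian is positive.\<close>

lemma harmonic_vanishing_nonpos:
  fixes h :: "real^'n::finite \<Rightarrow> real"
  assumes D: "\<And>x. (h has_derivative (\<lambda>k. G x \<bullet> k)) (at x)"
    and D2: "\<And>x j. ((\<lambda>x. G x $ j) has_derivative (\<lambda>k. H j x \<bullet> k)) (at x)"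
    and harm: "\<And>x. (\<Sum>j\<in>UNIV. H j x $ j) = 0"
    and lim: "\<And>e. 0 < e \<Longrightarrow> \<exists>R. \<forall>x. R \<le> norm x \<longrightarrow> \<bar>h x\<bar> < e"
  shows "h x \<le> 0"
proof (rule ccontr)
  assume "\<not> h x \<le> 0"
  define m where "m = h x"
  have m: "0 < m" using \<open>\<not> h x \<le> 0\<close> by (simp add: m_def)
  then obtain R0 where R0: "\<And>y. R0 \<le> norm y \<Longrightarrow> \<bar>h y\<bar> < m / 2" using lim[of "m / 2"] by auto
  define R where "R = max R0 (norm x + 1)"
  have R: "0 < R" "norm x \<le> R" "R0 \<le> R"
    using norm_ge_zero[of x] by (auto simp: R_def simp del: norm_ge_zero)
  \<comment> \<open>Now \<open>\<delta> * R\<^sup>2\<close> is \<open>m / 4\<close>, so on the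
    sphere of radius \<open>R\<close> the perturbed function stays below
    \<open>m / 2 + m / 4\<close>, while at \<open>x\<close> it is at least \<open>m\<close>. Its
    maximum over the ball is therefore interior.\<close>
  define \<delta> where "\<delta> = m / (4 * R\<^sup>2)"
  have \<delta>: "0 < \<delta>" "\<delta> * R\<^sup>2 = m / 4" using m R by (auto simp: \<delta>_def)
  define w where "w y = h y + \<delta> * (norm y)\<^sup>2" for y
  have "continuous_on (cball 0 R) h"
    using D by (intro continuous_at_imp_continuous_on ballI has_derivative_continuous)
  then have "continuous_on (cball 0 R) w"
    unfolding w_def by (intro continuous_intros)
  then obtain z where z: "z \<in> cball 0 R" "\<And>y. y \<in> cball 0 R \<Longrightarrow> w y \<le> w z"
    using continuous_attains_sup[OF compact_cball, of 0 R w] R by auto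
  have "m \<le> w x" using \<delta> by (simp add: w_def m_def)
  also have "w x \<le> w z" using R by (intro z) simp
  finally have mz: "m \<le> w z" .
  have "norm z \<noteq> R"
  proof
    assume "norm z = R"
    then have "w z < m / 2 + m / 4" using R0[of z] R \<delta> by (simp add: w_def)
    then show False using mz m by simp
  qed
  then have zR: "norm z < R" using z(1) by simp
  \<comment> \<open>Along each coordinate line the second derivative at the maximum is nonpositive;
    summing over \<open>j\<close> contradicts \<open>harm\<close>, because the terms
    \<open>2 * \<delta>\<close> remain.\<close>
  have "H j z $ j + 2 * \<delta> \<le> 0" for j
  proof (rule second_derivative_local_max)
    let ?l = "\<lambda>t. z + t *\<^sub>R axis j (1::real)"
    have l: "(?l has_derivative (\<lambda>k. k *\<^sub>R axis j 1)) (at t)" for t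
      by (auto intro!: derivative_eq_intros)
    have lh: "((\<lambda>t. h (?l t)) has_real_derivative G (?l t) $ j) (at t)" for t
      by (rule has_derivative_imp_has_field_derivative[OF has_derivative_compose[OF l D]])
        (simp add: inner_axis)
    have lG: "((\<lambda>t. G (?l t) $ j) has_real_derivative H j (?l t) $ j) (at t)" for t
      by (rule has_derivative_imp_has_field_derivative[OF has_derivative_compose[OF l D2]])
        (simp add: inner_axis)
    have sq: "(norm (?l t))\<^sup>2 = (norm z)\<^sup>2 + 2 * t * z $ j + t\<^sup>2" for t
      by (simp only: power2_norm_eq_inner)
        (simp add: inner_axis inner_axis_axis algebra_simps inner_commute power2_eq_square)
    show "((\<lambda>t. w (?l t)) has_real_derivative G (?l t) $ j + \<delta> * (2 * z $ j + 2 * t)) (at t)" for t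
      unfolding w_def sq by (auto intro!: derivative_eq_intros lh)
    show "((\<lambda>t. G (?l t) $ j + \<delta> * (2 * z $ j + 2 * t)) has_real_derivative H j z $ j + 2 * \<delta>) (at 0)"
      using lG[of 0] by (auto intro!: derivative_eq_intros)
    show "0 < R - norm z" using zR by simp
    show "w (?l t) \<le> w (?l 0)" if "\<bar>t\<bar> < R - norm z" for t
      using that norm_triangle_ineq[of z "t *\<^sub>R axis j 1"] by (simp, intro z) simp
  qed
  then have "(\<Sum>j\<in>UNIV. H j z $ j + 2 * \<delta>) \<le> (\<Sum>j\<in>(UNIV::'n set). 0)"
    by (intro sum_mono) auto
  then show False using \<delta> by (simp add: sum.distrib harm mult_le_0_iff)
qed

lemma harmonic_vanishing_eq_0:
  fixes h :: "real^'n::finite \<Rightarrow> real"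
  assumes D: "\<And>x. (h has_derivative (\<lambda>k. G x \<bullet> k)) (at x)"
    and D2: "\<And>x j. ((\<lambda>x. G x $ j) has_derivative (\<lambda>k. H j x \<bullet> k)) (at x)"
    and harm: "\<And>x. (\<Sum>j\<in>UNIV. H j x $ j) = 0"
    and lim: "\<And>e. 0 < e \<Longrightarrow> \<exists>R. \<forall>x. R \<le> norm x \<longrightarrow> \<bar>h x\<bar> < e"
  shows "h x = 0"
proof (rule antisym)
  show "h x \<le> 0" by (rule harmonic_vanishing_nonpos[OF assms])
  have "- h x \<le> 0"
  proof (rule harmonic_vanishing_nonpos)
    show "((\<lambda>x. - h x) has_derivative (\<lambda>k. (- G x) \<bullet> k)) (at x)" for x
      using has_derivative_minus[OF D] by simp
    show "((\<lambda>x. (- G x) $ j) has_derivative (\<lambda>k. (- H j x) \<bullet> k)) (at x)" for x j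
      using has_derivative_minus[OF D2] by simp
    show "(\<Sum>j\<in>UNIV. (- H j x) $ j) = 0" for x using harm[of x] by (simp add: sum_negf)
    show "\<exists>R. \<forall>x. R \<le> norm x \<longrightarrow> \<bar>- h x\<bar> < e" if "0 < e" for e using lim[OF that] by simp
  qed
  then show "0 \<le> h x" by simp
qed

section \<open>Decay at infinity and constants in the weighted space\<close>

lemma sq_integrable_indicator:
  assumes "sq_integrable M g" "A \<in> sets M"
  shows "sq_integrable M (\<lambda>y. indicator A y *\<^sub>R g y)"
proof -
  have meas: "(\<lambda>y. indicator A y *\<^sub>R g y) \<in> borel_measurable M"
    using assms by (intro borel_measurable_scaleR borel_measurable_indicator) (auto simp: sq_integrable_def)
  have "integrable M (\<lambda>y. (norm (indicator A y *\<^sub>R g y))\<^sup>2)"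
  proof (rule Bochner_Integration.integrable_bound)
    show "integrable M (\<lambda>y. (norm (g y))\<^sup>2)" using assms by (simp add: sq_integrable_def)
    show "(\<lambda>y. (norm (indicator A y *\<^sub>R g y))\<^sup>2) \<in> borel_measurable M"
      using meas by measurable
    show "AE y in M. norm ((norm (indicator A y *\<^sub>R g y))\<^sup>2) \<le> norm ((norm (g y))\<^sup>2)"
      by (intro AE_I2) (simp add: indicator_def)
  qed
  with meas show ?thesis by (simp add: sq_integrable_def)
qed

lemma sq_integrable_tail:
  fixes g :: "'a::euclidean_space \<Rightarrow> 'b::euclidean_space"
  assumes "sq_integrable lebesgue g"
  shows "(\<lambda>n. \<integral>y. (norm (indicator (- ball 0 (real n)) y *\<^sub>R g y))\<^sup>2 \<partial>lebesgue) \<longlonglongrightarrow> 0"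
proof -
  have g: "g \<in> borel_measurable lebesgue" "integrable lebesgue (\<lambda>y. (norm (g y))\<^sup>2)"
    using assms by (auto simp: sq_integrable_def)
  have "(\<lambda>n. \<integral>y. (norm (indicator (- ball 0 (real n)) y *\<^sub>R g y))\<^sup>2 \<partial>lebesgue) \<longlonglongrightarrow> integral\<^sup>L lebesgue (\<lambda>_::'a. 0::real)"
  proof (rule integral_dominated_convergence)
    show "(\<lambda>y. (norm (indicator (- ball 0 (real n)) y *\<^sub>R g y))\<^sup>2) \<in> borel_measurable lebesgue" for n
      using sq_integrable_indicator[OF assms, of "- ball 0 (real n)"] unfolding sq_integrable_def
      by (intro borel_measurable_integrable) simp
    show "AE y in lebesgue. (\<lambda>n. (norm (indicator (- ball 0 (real n)) y *\<^sub>R g y))\<^sup>2) \<longlonglongrightarrow> 0"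
    proof (intro AE_I2 tendsto_eventually)
      fix y :: 'a
      obtain m :: nat where "norm y < real m" using reals_Archimedean2 by blast
      then show "\<forall>\<^sub>F n in sequentially. (norm (indicator (- ball 0 (real n)) y *\<^sub>R g y))\<^sup>2 = 0"
        by (intro eventually_sequentiallyI[of m]) (auto simp: indicator_def)
    qed
    show "AE y in lebesgue. norm ((norm (indicator (- ball 0 (real n)) y *\<^sub>R g y))\<^sup>2) \<le> (norm (g y))\<^sup>2" for n
      by (intro AE_I2) (simp add: indicator_def)
  qed (use g in auto)
  then show ?thesis by simp
qed

text \<open>For \<open>x\<close> far out, the support of \<open>\<lambda>y. \<phi> (x - y)\<close>
  meets only the tail of \<open>g\<close>. Cauchy-Schwarz bounds the integral by the L2 norm of that
  tail, which tends to zero, times the L2 norm of \<open>\<phi>\<close>, which does not depend on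
  \<open>x\<close>.\<close>

lemma conv_vanishes_at_infinity:
  fixes g :: "real^'n::finite \<Rightarrow> real"
  assumes g: "sq_integrable lebesgue g" and \<phi>: "\<phi> \<in> test_functions" and e: "0 < e"
  shows "\<exists>R. \<forall>x. R \<le> norm x \<longrightarrow> \<bar>conv g \<phi> x\<bar> < e"
proof -
  let ?T = "\<lambda>n. \<integral>y. (norm (indicator (- ball 0 (real n)) y *\<^sub>R g y))\<^sup>2 \<partial>lebesgue"
  obtain r where r: "\<And>x. r < norm x \<Longrightarrow> \<phi> x = 0" using \<phi> test_functionsE by blast
  define Q where "Q = (\<integral>y. (norm (\<phi> (- y)))\<^sup>2 \<partial>lebesgue)"
  have Q: "(\<integral>y. (norm (\<phi> (x - y)))\<^sup>2 \<partial>lebesgue) = Q" for x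
  proof -
    have "continuous_on UNIV (\<lambda>y. (norm (\<phi> (- y)))\<^sup>2)"
      by (intro continuous_intros continuous_on_compose2[OF test_continuous[OF \<phi>]]) auto
    from lebesgue_integral_translate[OF this, of "- x"] show ?thesis by (simp add: Q_def)
  qed
  have "(\<lambda>n. ?T n * Q) \<longlonglongrightarrow> 0"
    using sq_integrable_tail[OF g] by (rule tendsto_mult_left_zero)
  then have "\<forall>\<^sub>F n in sequentially. ?T n * Q < e\<^sup>2"
    using e by (intro order_tendstoD) auto
  then obtain n where n: "?T n * Q < e\<^sup>2"
    unfolding eventually_sequentially by blast
  have "\<bar>conv g \<phi> x\<bar> < e" if x: "real n + r + 1 \<le> norm x" for x
  proof -
    have eq: "conv g \<phi> x = (\<integral>y. (indicator (- ball 0 (real n)) y *\<^sub>R g y) \<bullet> \<phi> (x - y) \<partial>lebesgue)"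
      unfolding conv_def
    proof (rule Bochner_Integration.integral_cong[OF refl])
      fix y
      show "g y * \<phi> (x - y) = (indicator (- ball 0 (real n)) y *\<^sub>R g y) \<bullet> \<phi> (x - y)"
      proof (cases "norm y < real n")
        case True
        then have "r < norm (x - y)" using x norm_triangle_ineq2[of x y] by simp
        then show ?thesis using r by simp
      qed simp
    qed
    have "(conv g \<phi> x)\<^sup>2 \<le> ?T n * (\<integral>y. (norm (\<phi> (x - y)))\<^sup>2 \<partial>lebesgue)"
      unfolding eq
    proof (rule Cauchy_Schwarz_integral)
      show "sq_integrable lebesgue (\<lambda>y. indicator (- ball 0 (real n)) y *\<^sub>R g y)"
        by (rule sq_integrable_indicator[OF g]) simp
      obtain s where "\<And>y. s < norm y \<Longrightarrow> \<phi> (x - y) = 0" by (rule test_functionsE[OF test_reflect[OF \<phi>, of x]]) (rule that)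
      then show "sq_integrable lebesgue (\<lambda>y. \<phi> (x - y))"
        by (rule sq_integrable_continuous_bounded_support[OF test_continuous[OF test_reflect[OF \<phi>]]])
    qed
    also have "\<dots> < e\<^sup>2" unfolding Q by (rule n)
    finally have "\<bar>conv g \<phi> x\<bar>\<^sup>2 < e\<^sup>2" by simp
    then show ?thesis by (rule power2_less_imp_less) (use e in simp)
  qed
  then show ?thesis by blast
qed

lemma weighted_sq: "(weighted v x)\<^sup>2 = (v x)\<^sup>2 / ((norm x)\<^sup>2 + 1)"
proof -
  have "0 < (norm x)\<^sup>2 + 1" by (simp add: add_nonneg_pos)
  then have "(((norm x)\<^sup>2 + 1) powr (- 1 / 2))\<^sup>2 = 1 / ((norm x)\<^sup>2 + 1)"
    by (simp add: power2_eq_square powr_minus_divide flip: powr_add)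
  then show ?thesis by (simp add: weighted_def power_mult_distrib)
qed

text \<open>On the cube of side \<open>R \<ge> 1\<close> the squared weight is at least
  \<open>1 / (4 * R\<^sup>2)\<close>, and the volume is \<open>R ^ 3\<close>; a constant
  \<open>c\<close> contributes at least \<open>c\<^sup>2 * R / 4\<close>, which is unbounded in
  \<open>R\<close> unless \<open>c = 0\<close>.\<close>

lemma const_weighted_eq_0:
  assumes "L2_on UNIV (weighted v)" "AE x in lebesgue. v x = c"
  shows "c = 0"
proof (rule ccontr)
  assume c: "c \<noteq> 0"
  have v: "integrable lebesgue (\<lambda>x. (norm (weighted v x))\<^sup>2)"
    using assms(1) by (simp add: L2_on_def lebesgue_on_UNIV_eq)
  define J where "J = (\<integral>x. (norm (weighted v x))\<^sup>2 \<partial>lebesgue)"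
  have bound: "c\<^sup>2 * R \<le> 4 * J" if R: "1 \<le> R" for R
  proof -
    let ?Q = "cbox 0 (\<chi> i. R) :: (real^3) set"
    have "(\<integral>x. c\<^sup>2 / (4 * R\<^sup>2) * indicator ?Q x \<partial>lebesgue) \<le> J"
      unfolding J_def
    proof (rule integral_mono_AE)
      show "integrable lebesgue (\<lambda>x. c\<^sup>2 / (4 * R\<^sup>2) * indicator ?Q x)"
        by (intro integrable_mult_right integrable_indicator_compact compact_cbox)
      show "AE x in lebesgue. c\<^sup>2 / (4 * R\<^sup>2) * indicator ?Q x \<le> (norm (weighted v x))\<^sup>2"
        using assms(2)
      proof eventually_elim
        case (elim x)
        show ?case
        proof (cases "x \<in> ?Q")
          case True
          then have "(x $ i)\<^sup>2 \<le> R\<^sup>2" for i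
            by (intro power_mono) (auto simp: mem_box_cart)
          then have "(\<Sum>i\<in>UNIV. (x $ i)\<^sup>2) \<le> (\<Sum>i\<in>(UNIV::3 set). R\<^sup>2)" by (intro sum_mono)
          moreover have norm_sq: "(norm x)\<^sup>2 = (\<Sum>i\<in>UNIV. (x $ i)\<^sup>2)"
            by (simp only: power2_norm_eq_inner) (simp add: inner_vec_def power2_eq_square)
          \<comment> \<open>Three coordinates give \<open>3 * R\<^sup>2\<close>, and
            \<open>1 \<le> R\<close> absorbs the remaining 1.\<close>
          ultimately have "(norm x)\<^sup>2 + 1 \<le> 4 * R\<^sup>2"
            using one_le_power[OF R, of 2] unfolding norm_sq sum_constant card_num1 by simp
          then have "c\<^sup>2 / (4 * R\<^sup>2) \<le> c\<^sup>2 / ((norm x)\<^sup>2 + 1)"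
            by (intro divide_left_mono mult_pos_pos) (use R in \<open>auto simp: add_nonneg_pos\<close>)
          then show ?thesis using True elim by (simp add: weighted_sq)
        qed simp
      qed
    qed (rule v)
    moreover have "(\<integral>x. indicator ?Q x \<partial>lebesgue) = R ^ 3"
      using R by (simp add: content_cbox_cart interval_ne_empty_cart)
    ultimately have "c\<^sup>2 / (4 * R\<^sup>2) * R ^ 3 \<le> J" by simp
    then show ?thesis using R by (simp add: power3_eq_cube power2_eq_square field_simps)
  qed
  \<comment> \<open>This makes \<open>c\<^sup>2 * R\<close> at least \<open>4 * J + 1\<close>, one
    more than \<open>bound\<close> allows.\<close>
  define R where "R = max 1 ((4 * J + 1) / c\<^sup>2)"
  have "4 * J + 1 \<le> c\<^sup>2 * R" using c by (simp add: R_def field_simps max_def)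
  then show False using bound[of R] by (simp add: R_def)
qed

text \<open>Mollifying with \<open>\<partial>\<^sub>i \<phi>\<close> turns \<open>z\<close> into a harmonic function \<open>g\<^sub>i * \<phi>\<close>, which tends to zero at
  infinity because \<open>g\<^sub>i\<close> is square integrable.\<close>

lemma borel_measurable_vec_nth:
  fixes g :: "'a \<Rightarrow> real^'n::finite"
  assumes "g \<in> borel_measurable M"
  shows "(\<lambda>x. g x $ i) \<in> borel_measurable M"
  using borel_measurable_inner[OF assms borel_measurable_const, of "axis i 1"] by (simp add: inner_axis)

theorem Liouville_W10:
  assumes z: "L2_on UNIV (weighted z)" "has_weak_gradient z g" "sq_integrable lebesgue g"
    and harm: "\<And>\<phi>. \<phi> \<in> test_functions \<Longrightarrow> (\<integral>x. g x \<bullet> grad \<phi> x \<partial>lebesgue) = 0"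
  shows "AE x in lebesgue. z x = 0"
proof -
  have zl: "locally_integrable z" using z(2) by (simp add: has_weak_gradient_iff)
  have gi: "sq_integrable lebesgue (\<lambda>y. g y $ i)" for i
  proof -
    have "integrable lebesgue (\<lambda>y. (norm (g y $ i))\<^sup>2)"
    proof (rule Bochner_Integration.integrable_bound)
      show "integrable lebesgue (\<lambda>y. (norm (g y))\<^sup>2)" using z(3) by (simp add: sq_integrable_def)
      show "(\<lambda>y. (norm (g y $ i))\<^sup>2) \<in> borel_measurable lebesgue"
        using borel_measurable_vec_nth[OF sq_integrable_measurable[OF z(3)]] by measurable
      have "(norm (g y $ i))\<^sup>2 \<le> (norm (g y))\<^sup>2" for y
        using component_le_norm_cart[of "g y" i] by (simp add: abs_le_square_iff[symmetric])
      then show "AE y in lebesgue. norm ((norm (g y $ i))\<^sup>2) \<le> norm ((norm (g y))\<^sup>2)" by simp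
    qed
    then show ?thesis using z(3) by (auto simp: sq_integrable_def intro!: borel_measurable_vec_nth)
  qed
  \<comment> \<open>In the form \<open>conv z (part_deriv i \<phi>)\<close> the function can be
    differentiated freely; in the form \<open>conv (\<lambda>y. g y $ i) \<phi>\<close> it is seen
    to decay. \<open>conv_weak_gradient\<close> identifies the two.\<close>
  have conv_0: "conv z (part_deriv i \<phi>) x = 0" if \<phi>: "\<phi> \<in> test_functions" for i \<phi> x
  proof (rule harmonic_vanishing_eq_0)
    let ?\<psi> = "part_deriv i \<phi>"
    have \<psi>: "?\<psi> \<in> test_functions" by (rule test_part_deriv[OF \<phi>])
    show "(conv z ?\<psi> has_derivative (\<lambda>k. (\<chi> j. conv z (part_deriv j ?\<psi>) x) \<bullet> k)) (at x)" for x
      by (rule conv_has_derivative[OF zl \<psi>])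
    show "((\<lambda>x. (\<chi> j. conv z (part_deriv j ?\<psi>) x) $ j) has_derivative
        (\<lambda>k. (\<chi> l. conv z (part_deriv l (part_deriv j ?\<psi>)) x) \<bullet> k)) (at x)" for x j
      using conv_has_derivative[OF zl test_part_deriv[OF \<psi>, of j]] by simp
    show "\<exists>R. \<forall>x. R \<le> norm x \<longrightarrow> \<bar>conv z ?\<psi> x\<bar> < e" if "0 < e" for e
      using conv_vanishes_at_infinity[OF gi \<phi> that] by (simp add: conv_weak_gradient[OF z(2) \<phi>])
    show "(\<Sum>j\<in>UNIV. (\<chi> l. conv z (part_deriv l (part_deriv j ?\<psi>)) x) $ j) = 0" for x
    proof -
      \<comment> \<open>One of the two derivatives is passed to \<open>z\<close>; up to sign the
        Laplacian becomes the pairing of \<open>g\<close> with the gradient of the reflected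
        \<open>?\<psi>\<close>, where \<open>harm\<close> applies.\<close>
      have "(\<Sum>j\<in>UNIV. conv z (part_deriv j (part_deriv j ?\<psi>)) x) =
          (\<Sum>j\<in>UNIV. \<integral>y. g y $ j * part_deriv j ?\<psi> (x - y) \<partial>lebesgue)"
        by (simp only: conv_weak_gradient[OF z(2) test_part_deriv[OF \<psi>]]) (simp only: conv_def)
      also have "\<dots> = (\<integral>y. (\<Sum>j\<in>UNIV. g y $ j * part_deriv j ?\<psi> (x - y)) \<partial>lebesgue)"
        by (rule Bochner_Integration.integral_sum[symmetric])
          (intro conv_integrable sq_integrable_imp_locally_integrable gi test_part_deriv \<psi>)
      also have "\<dots> = (\<integral>y. - (g y \<bullet> grad (\<lambda>y. ?\<psi> (x - y)) y) \<partial>lebesgue)"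
        by (simp add: inner_vec_def grad_def part_deriv_reflect[OF \<psi>] sum_negf)
      also have "\<dots> = 0" using harm[OF test_reflect[OF \<psi>]] by simp
      finally show ?thesis by simp
    qed
  qed
  have conv_const: "conv z \<phi> x = conv z \<phi> y" if \<phi>: "\<phi> \<in> test_functions" for \<phi> x y
  proof (rule has_derivative_zero_unique[of UNIV "conv z \<phi>"])
    show "(conv z \<phi> has_derivative (\<lambda>h. 0)) (at x)" for x
      using conv_has_derivative[OF zl \<phi>, of x] by (simp add: conv_0[OF \<phi>] inner_vec_def)
  qed auto
  \<comment> \<open>The convolution of \<open>z\<close> with the reflection of
    \<open>\<phi>\<close>, taken at \<open>- h\<close> and at 0, gives the two sides.\<close>
  have inv: "(\<integral>x. z x * \<phi> (x + h) \<partial>lebesgue) = (\<integral>x. z x * \<phi> x \<partial>lebesgue)"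
    if \<phi>: "\<phi> \<in> test_functions" for \<phi> h
    using conv_const[OF test_reflect[OF \<phi>, of 0], of "- h" 0] by (simp add: conv_def add.commute)
  obtain c where c: "AE x in lebesgue. z x = c"
    by (rule translation_invariant_AE_const[OF zl inv])
  then show ?thesis using const_weighted_eq_0[OF z(1) c] by simp
qed

section \<open>Hardy inequality and the projection onto gradients\<close>

lemma weighted_diff: "weighted (\<lambda>x. v x - w x) x = weighted v x - weighted w x"
  by (simp add: weighted_def right_diff_distrib)

lemma weighted_continuous:
  assumes "continuous_on UNIV v"
  shows "continuous_on UNIV (weighted v)"
proof -
  have "(norm x)\<^sup>2 + 1 \<noteq> 0" for x :: "real^3"
    using zero_le_power2[of "norm x"] by linarith
  then show ?thesis unfolding weighted_def[abs_def] by (intro continuous_intros assms) auto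
qed

lemma weighted_test_sq_integrable:
  assumes "\<phi> \<in> test_functions"
  shows "sq_integrable lebesgue (weighted \<phi>)"
proof -
  obtain r where "\<And>x. r < norm x \<Longrightarrow> \<phi> x = 0" using assms test_functionsE by blast
  then show ?thesis
    by (intro sq_integrable_continuous_bounded_support[where r = r] weighted_continuous test_continuous assms)
      (simp add: weighted_def)
qed

text \<open>The field \<open>X = x / (1 + |x|\<^sup>2)\<close> has divergence at least \<open>1 / (1 + |x|\<^sup>2)\<close>, and the integral of
  \<open>div (\<phi>\<^sup>2 X)\<close> is zero.\<close>

theorem Hardy_test:
  fixes \<phi> :: "real^3 \<Rightarrow> real"
  assumes \<phi>: "\<phi> \<in> test_functions"
  shows "(\<integral>x. (norm (weighted \<phi> x))\<^sup>2 \<partial>lebesgue) \<le> 4 * (\<integral>x. (norm (grad \<phi> x))\<^sup>2 \<partial>lebesgue)"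
proof -
  define w where "w x = inverse (1 + x \<bullet> x)" for x :: "real^3"
  have pos: "0 < 1 + x \<bullet> x" for x :: "real^3" by (simp add: add_pos_nonneg)
  have pos': "1 + x \<bullet> x \<noteq> 0" for x :: "real^3" using pos[of x] by simp
  have w_cont: "continuous_on UNIV w"
    unfolding w_def by (intro continuous_intros) (use pos' in auto)
  have w_deriv: "(w has_derivative (\<lambda>h. - (2 * (x \<bullet> h) * (w x * w x)))) (at x)" for x
    unfolding w_def[abs_def] using pos'[of x]
    by (auto intro!: derivative_eq_intros simp: fun_eq_iff inner_commute)
  \<comment> \<open>\<open>S i\<close> is the partial derivative in direction \<open>i\<close> of
    \<open>(\<phi> x)\<^sup>2 * x $ i * w x\<close>, written as the product rule delivers it;
    \<open>w\<close> is the squared weight.\<close>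
  define S where "S i x = (\<phi> x * \<phi> x) * (x $ i * - (2 * x $ i * (w x * w x)) + w x) +
    (\<phi> x * part_deriv i \<phi> x + part_deriv i \<phi> x * \<phi> x) * (x $ i * w x)" for i x
  obtain r where r: "\<And>x. r < norm x \<Longrightarrow> \<phi> x = 0" using \<phi> test_functionsE by blast
  have S_cont: "continuous_on UNIV (S i)" for i
    unfolding S_def
    by (intro continuous_intros test_continuous[OF \<phi>] test_continuous[OF test_part_deriv[OF \<phi>]] w_cont)
  have S_int: "(\<integral>x. S i x \<partial>lebesgue) = 0" for i
  proof -
    let ?\<psi> = "\<lambda>x. (\<phi> x * \<phi> x) * (x $ i * w x)"
    let ?\<psi>' = "\<lambda>x h. (\<phi> x * \<phi> x) * (x $ i * - (2 * (x \<bullet> h) * (w x * w x)) + h $ i * w x) +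
       (\<phi> x * (grad \<phi> x \<bullet> h) + (grad \<phi> x \<bullet> h) * \<phi> x) * (x $ i * w x)"
    have eq: "?\<psi>' x (axis i 1) = S i x" for x
      by (simp add: S_def inner_axis grad_def)
    have "(\<integral>x. ?\<psi>' x (axis i 1) \<partial>lebesgue) = 0"
    proof (rule integral_directional_derivative_eq_0[where \<psi> = ?\<psi> and \<psi>' = ?\<psi>'])
      show "(?\<psi> has_derivative ?\<psi>' x) (at x)" for x
        by (intro has_derivative_mult test_has_derivative[OF \<phi>] w_deriv
            bounded_linear_imp_has_derivative bounded_linear_vec_nth)
      show "continuous_on UNIV (\<lambda>x. ?\<psi>' x (axis i 1))" unfolding eq by (rule S_cont)
      show "?\<psi> x = 0" if "r < norm x" for x using r[OF that] by simp
    qed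
    then show ?thesis unfolding eq .
  qed
  have S_integrable: "integrable lebesgue (S i)" for i
    by (rule integrable_continuous_bounded_support[OF S_cont, of r]) (simp add: S_def r)
  \<comment> \<open>\<open>?f\<close> lies below the divergence for three reasons: the divergence of
    the field is at least \<open>w\<close>, \<open>sqrt (w x) * norm x \<le> 1\<close>, and Young's
    inequality splits the cross term with coefficients 1/2 and 2. The ratio of these is the constant
    4.\<close>
  let ?f = "\<lambda>x. (norm (weighted \<phi> x))\<^sup>2 / 2 - 2 * (norm (grad \<phi> x))\<^sup>2"
  have f_int: "integrable lebesgue (\<lambda>x. (norm (weighted \<phi> x))\<^sup>2)" "integrable lebesgue (\<lambda>x. (norm (grad \<phi> x))\<^sup>2)"
    using weighted_test_sq_integrable[OF \<phi>] test_grad_sq_integrable[OF \<phi>] by (auto simp: sq_integrable_def)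
  have "(\<integral>x. ?f x \<partial>lebesgue) \<le> (\<integral>x. (\<Sum>i\<in>UNIV. S i x) \<partial>lebesgue)"
  proof (rule integral_mono)
    show "integrable lebesgue ?f" using f_int by simp
    show "integrable lebesgue (\<lambda>x. \<Sum>i\<in>UNIV. S i x)" using S_integrable by simp
    fix x :: "real^3"
    have xx: "x \<bullet> x = (\<Sum>i\<in>UNIV. x $ i * x $ i)" by (simp add: inner_vec_def)
    have xg: "grad \<phi> x \<bullet> x = (\<Sum>i\<in>UNIV. part_deriv i \<phi> x * x $ i)" by (simp add: inner_vec_def grad_def)
    have sum_S: "(\<Sum>i\<in>UNIV. S i x) =
        (\<phi> x)\<^sup>2 * (3 * w x - 2 * (x \<bullet> x) * (w x)\<^sup>2) + 2 * \<phi> x * w x * (grad \<phi> x \<bullet> x)"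
      unfolding S_def xx xg UNIV_3 by (simp add: algebra_simps power2_eq_square)
    have w: "0 < w x" "(x \<bullet> x) * w x = 1 - w x"
      using pos[of x] by (auto simp: w_def field_simps)
    \<comment> \<open>The 3 is the dimension; with \<open>(x \<bullet> x) * w x = 1 - w x\<close>
      the divergence of the field equals \<open>w x + 2 * (w x)\<^sup>2\<close>.\<close>
    have "3 * w x - 2 * (x \<bullet> x) * (w x)\<^sup>2 = 3 * w x - 2 * ((x \<bullet> x) * w x) * w x"
      by (simp add: power2_eq_square)
    also have "\<dots> = w x + 2 * (w x)\<^sup>2"
      unfolding w(2) by (simp add: algebra_simps power2_eq_square)
    finally have div: "w x \<le> 3 * w x - 2 * (x \<bullet> x) * (w x)\<^sup>2" by simp
    have wt: "(norm (weighted \<phi> x))\<^sup>2 = (\<phi> x)\<^sup>2 * w x"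
      by (simp add: weighted_sq w_def power2_norm_eq_inner divide_inverse add.commute)
    have "\<bar>\<phi> x * w x * (grad \<phi> x \<bullet> x)\<bar> \<le> (\<bar>\<phi> x\<bar> * sqrt (w x)) * norm (grad \<phi> x)"
    proof -
      have "sqrt (w x) * norm x \<le> 1"
      proof -
        have "sqrt (w x) * norm x = sqrt ((x \<bullet> x) * w x)"
          by (simp add: norm_eq_sqrt_inner real_sqrt_mult mult.commute)
        then show ?thesis using w by simp
      qed
      then have "(\<bar>\<phi> x\<bar> * sqrt (w x) * norm (grad \<phi> x)) * (sqrt (w x) * norm x) \<le> (\<bar>\<phi> x\<bar> * sqrt (w x) * norm (grad \<phi> x)) * 1"
        using w by (intro mult_left_mono) auto
      moreover have "\<bar>\<phi> x * w x * (grad \<phi> x \<bullet> x)\<bar> \<le> (\<bar>\<phi> x\<bar> * w x) * (norm (grad \<phi> x) * norm x)"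
        unfolding abs_mult using w Cauchy_Schwarz_ineq2[of "grad \<phi> x" x]
        by (intro mult_mono) auto
      moreover have "(\<bar>\<phi> x\<bar> * (sqrt (w x) * sqrt (w x))) * (norm (grad \<phi> x) * norm x) =
          (\<bar>\<phi> x\<bar> * sqrt (w x) * norm (grad \<phi> x)) * (sqrt (w x) * norm x)"
        by (simp only: ac_simps)
      then have "(\<bar>\<phi> x\<bar> * w x) * (norm (grad \<phi> x) * norm x) =
          (\<bar>\<phi> x\<bar> * sqrt (w x) * norm (grad \<phi> x)) * (sqrt (w x) * norm x)"
        using w by simp
      ultimately show ?thesis by simp
    qed
    moreover have "2 * (\<bar>\<phi> x\<bar> * sqrt (w x)) * norm (grad \<phi> x) \<le> (\<phi> x)\<^sup>2 * w x / 2 + 2 * (norm (grad \<phi> x))\<^sup>2"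
    proof -
      have "2 * (\<bar>\<phi> x\<bar> * sqrt (w x)) * (2 * norm (grad \<phi> x)) \<le> (\<bar>\<phi> x\<bar> * sqrt (w x))\<^sup>2 + (2 * norm (grad \<phi> x))\<^sup>2"
        by (rule sum_squares_bound)
      then show ?thesis using w by (simp add: power_mult_distrib)
    qed
    moreover have "(\<phi> x)\<^sup>2 * w x \<le> (\<phi> x)\<^sup>2 * (3 * w x - 2 * (x \<bullet> x) * (w x)\<^sup>2)"
      by (intro mult_left_mono div) simp
    ultimately show "?f x \<le> (\<Sum>i\<in>UNIV. S i x)"
      unfolding sum_S wt by (simp add: mult.assoc)
  qed
  also have "\<dots> = 0" using S_integrable by (simp add: S_int)
  finally show ?thesis using f_int by simp
qed

text \<open>\<open>G\<close> is the orthogonal projection of \<open>F\<close> onto the closure of the gradients of test functions;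
  Hardy's inequality makes the minimising sequence converge in the weighted space.\<close>

theorem gradient_projection:
  fixes F :: "real^3 \<Rightarrow> real^3"
  assumes F: "sq_integrable lebesgue F"
  obtains u G \<phi> where
    "\<And>n::nat. \<phi> n \<in> test_functions"
    "(\<lambda>n. \<integral>x. (norm (grad (\<phi> n) x - G x))\<^sup>2 \<partial>lebesgue) \<longlonglongrightarrow> 0"
    "sq_integrable lebesgue G" "has_weak_gradient u G" "sq_integrable lebesgue (weighted u)"
    "\<And>\<psi>. \<psi> \<in> test_functions \<Longrightarrow> (\<integral>x. (F x - G x) \<bullet> grad \<psi> x \<partial>lebesgue) = 0"
    "(\<integral>x. (norm (G x))\<^sup>2 \<partial>lebesgue) \<le> (\<integral>x. (norm (F x))\<^sup>2 \<partial>lebesgue)"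
    "(\<integral>x. (norm (weighted u x))\<^sup>2 \<partial>lebesgue) \<le> 4 * (\<integral>x. (norm (G x))\<^sup>2 \<partial>lebesgue)"
proof -
  define E where "E \<psi> = (\<integral>x. (norm (F x - grad \<psi> x))\<^sup>2 \<partial>lebesgue)" for \<psi>
  define D where "D = Inf (E ` test_functions)"
  have bdd: "bdd_below (E ` test_functions)"
    by (intro bdd_belowI[of _ 0]) (auto simp: E_def)
  have D_le: "D \<le> E \<psi>" if "\<psi> \<in> test_functions" for \<psi>
    unfolding D_def using bdd that by (intro cInf_lower) auto
  \<comment> \<open>The excess \<open>(1/4)^n\<close> produces the rate that
    \<open>Riesz_Fischer_fast\<close> demands; \<open>box_bump_test\<close> shows that the infimum
    is over a nonempty set.\<close>
  have "\<exists>\<psi>\<in>test_functions. E \<psi> < D + (1/4)^n" for n :: nat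
    using cInf_lessD[of "E ` test_functions" "D + (1/4)^n"] box_bump_test unfolding D_def by fastforce
  then obtain \<phi> where \<phi>: "\<And>n::nat. \<phi> n \<in> test_functions" "\<And>n. E (\<phi> n) < D + (1/4)^n"
    by metis
  note sqg = test_grad_sq_integrable[OF \<phi>(1)]
  have cauchy: "(\<integral>x. (norm (grad (\<phi> m) x - grad (\<phi> n) x))\<^sup>2 \<partial>lebesgue) \<le> 4 * (1/4)^n" if "n \<le> m" for m n
  proof -
    let ?a = "\<lambda>x. F x - grad (\<phi> m) x" and ?b = "\<lambda>x. F x - grad (\<phi> n) x"
    let ?m = "\<lambda>x. (1/2) * \<phi> m x + (1/2) * \<phi> n x"
    have mtest: "?m \<in> test_functions" by (intro test_comb \<phi>)
    have int: "integrable lebesgue (\<lambda>x. (norm (?a x))\<^sup>2)" "integrable lebesgue (\<lambda>x. (norm (?b x))\<^sup>2)"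
      "integrable lebesgue (\<lambda>x. (norm (F x - grad ?m x))\<^sup>2)"
      using sq_integrable_diff[OF F sqg] sq_integrable_diff[OF F test_grad_sq_integrable[OF mtest]]
      by (auto simp: sq_integrable_def)
    \<comment> \<open>Parallelogram law: the midpoint \<open>?m\<close> is again a test function, so
      \<open>E ?m\<close> is at least \<open>D\<close>, and only the excesses of
      \<open>\<phi> m\<close> and \<open>\<phi> n\<close> remain, at most
      \<open>2 * (1/4)^m + 2 * (1/4)^n\<close>.\<close>
    have par: "(norm (grad (\<phi> m) x - grad (\<phi> n) x))\<^sup>2 =
        2 * (norm (?a x))\<^sup>2 + 2 * (norm (?b x))\<^sup>2 - 4 * (norm (F x - grad ?m x))\<^sup>2" for x
      unfolding test_grad_comb[OF \<phi>(1) \<phi>(1)]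
      by (simp only: power2_norm_eq_inner) (simp add: inner_commute algebra_simps)
    have "(\<integral>x. (norm (grad (\<phi> m) x - grad (\<phi> n) x))\<^sup>2 \<partial>lebesgue) = 2 * E (\<phi> m) + 2 * E (\<phi> n) - 4 * E ?m"
      unfolding par E_def using int by simp
    moreover have "(1/4::real)^m \<le> (1/4)^n" using that by (intro power_decreasing) auto
    ultimately show ?thesis using \<phi>(2)[of m] \<phi>(2)[of n] D_le[OF mtest] by linarith
  qed
  obtain G where G: "sq_integrable lebesgue G" "(\<lambda>n. \<integral>x. (norm (grad (\<phi> n) x - G x))\<^sup>2 \<partial>lebesgue) \<longlonglongrightarrow> 0"
    using Riesz_Fischer_fast[of lebesgue "\<lambda>n. grad (\<phi> n)", OF sqg cauchy] by blast
  have cauchy_w: "(\<integral>x. (norm (weighted (\<phi> m) x - weighted (\<phi> n) x))\<^sup>2 \<partial>lebesgue) \<le> 16 * (1/4)^n" if "n \<le> m" for m n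
  proof -
    have "(\<lambda>x. \<phi> m x - \<phi> n x) \<in> test_functions" "\<And>x. grad (\<lambda>x. \<phi> m x - \<phi> n x) x = grad (\<phi> m) x - grad (\<phi> n) x"
      using test_comb[OF \<phi>(1) \<phi>(1), of 1 m "-1" n] test_grad_comb[OF \<phi>(1) \<phi>(1), of 1 m "-1" n] by simp_all
    with Hardy_test[of "\<lambda>x. \<phi> m x - \<phi> n x"] cauchy[OF that] show ?thesis
      by (simp add: weighted_diff)
  qed
  note sqw = weighted_test_sq_integrable[OF \<phi>(1)]
  obtain W where W: "sq_integrable lebesgue W" "(\<lambda>n. \<integral>x. (norm (weighted (\<phi> n) x - W x))\<^sup>2 \<partial>lebesgue) \<longlonglongrightarrow> 0"
    using Riesz_Fischer_fast[of lebesgue "\<lambda>n. weighted (\<phi> n)", OF sqw cauchy_w] by blast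
  define s where "s x = sqrt ((norm x)\<^sup>2 + 1)" for x :: "real^3"
  have s_cont: "continuous_on UNIV s" unfolding s_def by (intro continuous_intros)
  have s_weight: "weighted v x * s x = v x" for v x
  proof -
    have "0 < (norm x)\<^sup>2 + 1" by (simp add: add_nonneg_pos)
    then have "((norm x)\<^sup>2 + 1) powr (- 1 / 2) * s x = 1"
      by (simp add: s_def powr_half_sqrt[symmetric] flip: powr_add)
    then show ?thesis by (simp add: weighted_def mult.commute mult.left_commute)
  qed
  \<comment> \<open>The L2 limit exists only after weighting; multiplying by \<open>s\<close>, the
    reciprocal of the weight, recovers the function itself.\<close>
  define u where "u x = W x * s x" for x
  have wu: "weighted u = W"
  proof
    fix x
    have "0 < s x" by (simp add: s_def add_nonneg_pos)
    then show "weighted u x = W x" using s_weight[of u x] by (simp add: u_def)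
  qed
  have grad: "has_weak_gradient u G"
    unfolding has_weak_gradient_iff
  proof (intro conjI allI ballI)
    show "locally_integrable u" unfolding u_def
      using locally_integrable_scaleR[OF sq_integrable_imp_locally_integrable[OF W(1)] s_cont] by (simp add: mult.commute)
    show "locally_integrable G" by (rule sq_integrable_imp_locally_integrable[OF G(1)])
    fix i and \<psi> :: "real^3 \<Rightarrow> real" assume \<psi>: "\<psi> \<in> test_functions"
    have p\<psi>: "part_deriv i \<psi> \<in> test_functions" by (rule test_part_deriv[OF \<psi>])
    obtain r where r: "\<And>x. r < norm x \<Longrightarrow> \<psi> x = 0" using \<psi> test_functionsE by blast
    obtain r' where r': "\<And>x. r' < norm x \<Longrightarrow> part_deriv i \<psi> x = 0" using p\<psi> test_functionsE by blast
    \<comment> \<open>Shifting \<open>s\<close> onto the test function turns the pairing with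
      \<open>\<phi> n\<close> into one with \<open>weighted (\<phi> n)\<close>, for which L2
      convergence is available.\<close>
    have "sq_integrable lebesgue (\<lambda>x. s x * part_deriv i \<psi> x)"
      by (intro sq_integrable_continuous_bounded_support[where r = r'] continuous_intros s_cont test_continuous p\<psi>)
        (simp add: r')
    from L2_limit_inner[OF sqw W(1) this W(2)]
    have "(\<lambda>n. \<integral>x. \<phi> n x * part_deriv i \<psi> x \<partial>lebesgue) \<longlonglongrightarrow> (\<integral>x. u x * part_deriv i \<psi> x \<partial>lebesgue)"
      by (simp add: s_weight u_def flip: mult.assoc)
    moreover have "sq_integrable lebesgue (\<lambda>x. \<psi> x *\<^sub>R axis i (1::real))"
      by (intro sq_integrable_continuous_bounded_support[where r = r] continuous_intros test_continuous \<psi>)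
        (simp add: r)
    from L2_limit_inner[OF sqg G(1) this G(2)]
    have "(\<lambda>n. \<integral>x. grad (\<phi> n) x $ i * \<psi> x \<partial>lebesgue) \<longlonglongrightarrow> (\<integral>x. G x $ i * \<psi> x \<partial>lebesgue)"
      by (simp add: inner_axis mult.commute)
    then have "(\<lambda>n. - (\<integral>x. grad (\<phi> n) x $ i * \<psi> x \<partial>lebesgue)) \<longlonglongrightarrow> - (\<integral>x. G x $ i * \<psi> x \<partial>lebesgue)"
      by (rule tendsto_minus)
    moreover have "(\<integral>x. \<phi> n x * part_deriv i \<psi> x \<partial>lebesgue) = - (\<integral>x. grad (\<phi> n) x $ i * \<psi> x \<partial>lebesgue)" for n
      using test_has_weak_gradient[OF \<phi>(1), of n] \<psi> unfolding has_weak_gradient_iff by blast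
    ultimately show "(\<integral>x. u x * part_deriv i \<psi> x \<partial>lebesgue) = - (\<integral>x. G x $ i * \<psi> x \<partial>lebesgue)"
      using LIMSEQ_unique by simp
  qed
  have FG: "sq_integrable lebesgue (\<lambda>x. F x - G x)" by (rule sq_integrable_diff[OF F G(1)])
  have orth: "(\<integral>x. (F x - G x) \<bullet> grad \<psi> x \<partial>lebesgue) = 0" if \<psi>: "\<psi> \<in> test_functions" for \<psi>
  proof -
    define c where "c = (\<integral>x. (norm (grad \<psi> x))\<^sup>2 \<partial>lebesgue)"
    note sq\<psi> = test_grad_sq_integrable[OF \<psi>]
    let ?b = "\<lambda>n. \<integral>x. (F x - grad (\<phi> n) x) \<bullet> grad \<psi> x \<partial>lebesgue"
    have b_le: "(?b n)\<^sup>2 \<le> (1/4)^n * c" for n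
    proof -
      \<comment> \<open>Moving \<open>\<phi> n\<close> in direction \<open>\<psi>\<close> cannot
        bring \<open>E\<close> below \<open>D\<close>, so a quadratic in \<open>t\<close> is
        nonnegative, and its discriminant limits the cross term by the excess, which tends to
        0.\<close>
      have "(?b n)\<^sup>2 \<le> (E (\<phi> n) - D) * c"
      proof (rule discriminant_le)
        fix t
        have "D \<le> E (\<lambda>x. 1 * \<phi> n x + (- t) * \<psi> x)" by (intro D_le test_comb \<phi> \<psi>)
        also have "\<dots> = (\<integral>x. (norm ((F x - grad (\<phi> n) x) + t *\<^sub>R grad \<psi> x))\<^sup>2 \<partial>lebesgue)"
          unfolding E_def test_grad_comb[OF \<phi>(1) \<psi>] by (simp add: algebra_simps)
        also have "\<dots> = E (\<phi> n) + 2 * t * ?b n + t\<^sup>2 * c"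
          unfolding E_def c_def by (rule integral_norm_sq_comb[OF sq_integrable_diff[OF F sqg] sq\<psi>])
        finally show "0 \<le> (E (\<phi> n) - D) + 2 * t * ?b n + t\<^sup>2 * c" by simp
      qed (simp add: c_def)
      also have "\<dots> \<le> (1/4)^n * c" using \<phi>(2)[of n] by (intro mult_right_mono) (auto simp: c_def)
      finally show ?thesis .
    qed
    have "(\<lambda>n. (1/4)^n * c) \<longlonglongrightarrow> 0"
      by (intro tendsto_mult_left_zero LIMSEQ_realpow_zero) auto
    then have "(\<lambda>n. (?b n)\<^sup>2) \<longlonglongrightarrow> 0"
      by (rule Lim_null_comparison[rotated]) (use b_le in \<open>auto intro: eventuallyI\<close>)
    then have lim_0: "?b \<longlonglongrightarrow> 0" by (subst (asm) power_tendsto_0_iff) auto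
    have lim_b: "?b \<longlonglongrightarrow> (\<integral>x. F x \<bullet> grad \<psi> x \<partial>lebesgue) - (\<integral>x. G x \<bullet> grad \<psi> x \<partial>lebesgue)"
      unfolding inner_diff_left
      by (simp add: sq_integrable_inner F sqg sq\<psi>)
        (intro tendsto_intros L2_limit_inner[OF sqg G(1) sq\<psi> G(2)])
    show ?thesis
      using LIMSEQ_unique[OF lim_b lim_0] by (simp add: inner_diff_left sq_integrable_inner F G(1) sq\<psi>)
  qed
  \<comment> \<open>Orthogonality to each \<open>grad (\<phi> n)\<close> passes to the limit
    \<open>G\<close>, and Pythagoras then gives the norm bound.\<close>
  have "(\<lambda>n. \<integral>x. grad (\<phi> n) x \<bullet> (F x - G x) \<partial>lebesgue) \<longlonglongrightarrow> (\<integral>x. G x \<bullet> (F x - G x) \<partial>lebesgue)"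
    by (rule L2_limit_inner[OF sqg G(1) FG G(2)])
  then have "(\<integral>x. (F x - G x) \<bullet> G x \<partial>lebesgue) = 0"
    using orth[OF \<phi>(1)] by (simp add: inner_commute LIMSEQ_const_iff)
  then have "(\<integral>x. (norm (F x))\<^sup>2 \<partial>lebesgue) = (\<integral>x. (norm (F x - G x))\<^sup>2 \<partial>lebesgue) + (\<integral>x. (norm (G x))\<^sup>2 \<partial>lebesgue)"
    using integral_norm_sq_comb[OF FG G(1), of 1] by simp
  then have norm_G: "(\<integral>x. (norm (G x))\<^sup>2 \<partial>lebesgue) \<le> (\<integral>x. (norm (F x))\<^sup>2 \<partial>lebesgue)" by simp
  have le_W: "(\<integral>x. (norm (W x))\<^sup>2 \<partial>lebesgue) \<le> 4 * (\<integral>x. (norm (G x))\<^sup>2 \<partial>lebesgue)"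
  proof (rule LIMSEQ_le)
    show "(\<lambda>n. \<integral>x. (norm (weighted (\<phi> n) x))\<^sup>2 \<partial>lebesgue) \<longlonglongrightarrow> (\<integral>x. (norm (W x))\<^sup>2 \<partial>lebesgue)"
      by (rule L2_limit_norm[OF sqw W])
    show "(\<lambda>n. 4 * (\<integral>x. (norm (grad (\<phi> n) x))\<^sup>2 \<partial>lebesgue)) \<longlonglongrightarrow> 4 * (\<integral>x. (norm (G x))\<^sup>2 \<partial>lebesgue)"
      by (intro tendsto_intros L2_limit_norm[OF sqg G])
    show "\<exists>N. \<forall>n\<ge>N. (\<integral>x. (norm (weighted (\<phi> n) x))\<^sup>2 \<partial>lebesgue) \<le> 4 * (\<integral>x. (norm (grad (\<phi> n) x))\<^sup>2 \<partial>lebesgue)"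
      by (intro exI allI impI Hardy_test \<phi>)
  qed
  show thesis
    by (rule that[OF \<phi>(1) G(2,1) grad _ orth norm_G]) (use W(1) le_W in \<open>auto simp only: wu\<close>)
qed

section \<open>The space \<open>W10\<close> and the two notions of solution\<close>

lemma L2_on_UNIV: "L2_on UNIV = sq_integrable lebesgue"
  by (simp add: L2_on_eq lebesgue_on_UNIV_eq)

text \<open>Membership in \<open>W10\<close> promises only some square integrable weak gradient,
  while \<open>weak_grad\<close> may choose another; the two agree almost everywhere, so the choice
  inherits integrability.\<close>

lemma weak_grad_W10:
  assumes "v \<in> W10"
  shows "has_weak_gradient v (weak_grad v)" "sq_integrable lebesgue (weak_grad v)"
    "sq_integrable lebesgue (weighted v)"
proof -
  obtain g where g: "has_weak_gradient v g" "sq_integrable lebesgue g" and w: "sq_integrable lebesgue (weighted v)"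
    using assms unfolding W10_def L2_on_UNIV by blast
  show wg: "has_weak_gradient v (weak_grad v)"
    unfolding weak_grad_def by (rule someI[of "has_weak_gradient v", OF g(1)])
  have ae: "AE x in lebesgue. weak_grad v x = g x" by (rule weak_grad_AE_eq[OF g(1)])
  have meas: "weak_grad v \<in> borel_measurable lebesgue" "g \<in> borel_measurable lebesgue"
    using wg g(1) by (auto simp: has_weak_gradient_iff intro: locally_integrable_measurable)
  have "integrable lebesgue (\<lambda>x. (norm (weak_grad v x))\<^sup>2) \<longleftrightarrow> integrable lebesgue (\<lambda>x. (norm (g x))\<^sup>2)"
  proof (rule integrable_cong_AE)
    show "AE x in lebesgue. (norm (weak_grad v x))\<^sup>2 = (norm (g x))\<^sup>2" using ae by eventually_elim simp
  qed (use meas in measurable)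
  then show "sq_integrable lebesgue (weak_grad v)" using g(2) meas by (simp add: sq_integrable_def)
  show "sq_integrable lebesgue (weighted v)" by (rule w)
qed

lemma W10_I:
  "sq_integrable lebesgue (weighted v) \<Longrightarrow> has_weak_gradient v g \<Longrightarrow> sq_integrable lebesgue g \<Longrightarrow> v \<in> W10"
  unfolding W10_def L2_on_UNIV by blast

lemma test_W10: "\<phi> \<in> test_functions \<Longrightarrow> \<phi> \<in> W10"
  by (rule W10_I[OF weighted_test_sq_integrable test_has_weak_gradient test_grad_sq_integrable])

text \<open>The difference is weakly harmonic, so \<open>Liouville_W10\<close> applies. Only
  pairings with test functions are compared, so this serves uniqueness of distributional solutions
  as well as the density argument.\<close>

lemma W10_unique:
  assumes v: "v \<in> W10" and w: "w \<in> W10"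
    and eq: "\<And>\<phi>. \<phi> \<in> test_functions \<Longrightarrow>
      (\<integral>x. weak_grad v x \<bullet> grad \<phi> x \<partial>lebesgue) = (\<integral>x. weak_grad w x \<bullet> grad \<phi> x \<partial>lebesgue)"
  shows "AE x in lebesgue. v x = w x"
proof -
  have "AE x in lebesgue. v x - w x = 0"
  proof (rule Liouville_W10)
    show "L2_on UNIV (weighted (\<lambda>x. v x - w x))"
      using sq_integrable_diff[OF weak_grad_W10(3)[OF v] weak_grad_W10(3)[OF w]]
      unfolding L2_on_UNIV by (simp add: weighted_diff[abs_def])
    show "has_weak_gradient (\<lambda>x. v x - w x) (\<lambda>x. weak_grad v x - weak_grad w x)"
      by (intro has_weak_gradient_diff weak_grad_W10 v w)
    show "sq_integrable lebesgue (\<lambda>x. weak_grad v x - weak_grad w x)"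
      by (intro sq_integrable_diff weak_grad_W10 v w)
    show "(\<integral>x. (weak_grad v x - weak_grad w x) \<bullet> grad \<phi> x \<partial>lebesgue) = 0" if "\<phi> \<in> test_functions" for \<phi>
      using eq[OF that] weak_grad_W10(2)[OF v] weak_grad_W10(2)[OF w] test_grad_sq_integrable[OF that]
      by (simp add: inner_diff_left sq_integrable_inner)
  qed
  then show ?thesis by eventually_elim simp
qed

lemma weak_grad_cong_AE:
  assumes "v \<in> W10" "w \<in> W10" "AE x in lebesgue. v x = w x"
  shows "AE x in lebesgue. weak_grad v x = weak_grad w x"
proof -
  have "AE x in lebesgue. v x - w x = 0" using assms(3) by eventually_elim simp
  with weak_gradient_AE_0[OF has_weak_gradient_diff[OF weak_grad_W10(1)[OF assms(1)] weak_grad_W10(1)[OF assms(2)]]]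
  show ?thesis by simp
qed

lemma integral_inner_cong_AE:
  assumes "AE x in M. f x = g x" "sq_integrable M f" "sq_integrable M g" "sq_integrable M h"
  shows "(\<integral>x. h x \<bullet> f x \<partial>M) = (\<integral>x. h x \<bullet> g x \<partial>M)"
proof (rule integral_cong_AE)
  show "AE x in M. h x \<bullet> f x = h x \<bullet> g x" using assms(1) by eventually_elim simp
qed (auto intro!: borel_measurable_integrable sq_integrable_inner assms)

text \<open>Projecting the gradient of \<open>v\<close> itself gives, by uniqueness, an approximation of \<open>v\<close> by test
  functions, so orthogonality to gradients extends from test functions to the whole space.\<close>

lemma orthogonal_weak_grad:
  assumes F: "sq_integrable lebesgue F"
    and orth: "\<And>\<phi>. \<phi> \<in> test_functions \<Longrightarrow> (\<integral>x. F x \<bullet> grad \<phi> x \<partial>lebesgue) = 0"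
    and v: "v \<in> W10"
  shows "(\<integral>x. F x \<bullet> weak_grad v x \<partial>lebesgue) = 0"
proof -
  note gv = weak_grad_W10[OF v]
  obtain u G \<phi> where \<phi>: "\<And>n::nat. \<phi> n \<in> test_functions"
    and lim: "(\<lambda>n. \<integral>x. (norm (grad (\<phi> n) x - G x))\<^sup>2 \<partial>lebesgue) \<longlonglongrightarrow> 0"
    and G: "sq_integrable lebesgue G" and u: "has_weak_gradient u G" "sq_integrable lebesgue (weighted u)"
    and proj: "\<And>\<psi>. \<psi> \<in> test_functions \<Longrightarrow> (\<integral>x. (weak_grad v x - G x) \<bullet> grad \<psi> x \<partial>lebesgue) = 0"
    by (rule gradient_projection[OF gv(2)]) (rule that)
  have uW: "u \<in> W10" by (rule W10_I[OF u(2,1) G])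
  have Gu: "AE x in lebesgue. weak_grad u x = G x" by (rule weak_grad_AE_eq[OF u(1)])
  have "AE x in lebesgue. v x = u x"
  proof (rule W10_unique[OF v uW])
    fix \<psi> :: "real^3 \<Rightarrow> real" assume \<psi>: "\<psi> \<in> test_functions"
    note sq\<psi> = test_grad_sq_integrable[OF \<psi>]
    have "(\<integral>x. weak_grad v x \<bullet> grad \<psi> x \<partial>lebesgue) = (\<integral>x. G x \<bullet> grad \<psi> x \<partial>lebesgue)"
      using proj[OF \<psi>] by (simp add: inner_diff_left sq_integrable_inner gv(2) G sq\<psi>)
    also have "\<dots> = (\<integral>x. weak_grad u x \<bullet> grad \<psi> x \<partial>lebesgue)"
      using integral_inner_cong_AE[OF Gu weak_grad_W10(2)[OF uW] G sq\<psi>] by (simp add: inner_commute)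
    finally show "(\<integral>x. weak_grad v x \<bullet> grad \<psi> x \<partial>lebesgue) = (\<integral>x. weak_grad u x \<bullet> grad \<psi> x \<partial>lebesgue)" .
  qed
  then have "AE x in lebesgue. weak_grad v x = G x"
    using weak_grad_cong_AE[OF v uW] Gu by (auto elim: eventually_elim2)
  then have "(\<integral>x. F x \<bullet> weak_grad v x \<partial>lebesgue) = (\<integral>x. F x \<bullet> G x \<partial>lebesgue)"
    by (rule integral_inner_cong_AE[OF _ gv(2) G F])
  \<comment> \<open>\<open>F\<close> is orthogonal to every \<open>grad (\<phi> n)\<close>, and
    these tend in L2 to \<open>G\<close>, now known to be the weak gradient of \<open>v\<close>
    almost everywhere.\<close>
  moreover have "(\<lambda>n. \<integral>x. grad (\<phi> n) x \<bullet> F x \<partial>lebesgue) \<longlonglongrightarrow> (\<integral>x. G x \<bullet> F x \<partial>lebesgue)"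
    by (rule L2_limit_inner[OF test_grad_sq_integrable[OF \<phi>] G F lim])
  then have "(\<integral>x. G x \<bullet> F x \<partial>lebesgue) = 0"
    using orth[OF \<phi>] by (simp add: inner_commute LIMSEQ_const_iff)
  ultimately show ?thesis by (simp add: inner_commute)
qed

text \<open>In the Laplacian two derivatives land on the test function, and one is moved back by the
  weak gradient, which costs a minus sign. The divergence carries the same sign, so cancelling
  leaves the weak form.\<close>

lemma distributional_solution_iff:
  assumes F: "sq_integrable lebesgue (\<lambda>x. indicator \<Omega> x *\<^sub>R M x)"
  shows "distributional_solution \<Omega> M w \<longleftrightarrow> w \<in> W10 \<and> (\<forall>\<phi>\<in>test_functions.
    (\<integral>x. weak_grad w x \<bullet> grad \<phi> x \<partial>lebesgue) = (\<integral>x. (indicator \<Omega> x *\<^sub>R M x) \<bullet> grad \<phi> x \<partial>lebesgue))"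
proof (cases "w \<in> W10")
  case True
  have sum_inner: "(\<Sum>i\<in>UNIV. \<integral>x. g x $ i * part_deriv i \<phi> x \<partial>lebesgue) = (\<integral>x. g x \<bullet> grad \<phi> x \<partial>lebesgue)"
    if g: "sq_integrable lebesgue g" and \<phi>: "\<phi> \<in> test_functions" for g :: "real^3 \<Rightarrow> real^3" and \<phi>
  proof -
    have "(\<integral>x. g x \<bullet> grad \<phi> x \<partial>lebesgue) = (\<integral>x. (\<Sum>i\<in>UNIV. g x $ i * part_deriv i \<phi> x) \<partial>lebesgue)"
      by (simp add: inner_vec_def grad_def)
    also have "\<dots> = (\<Sum>i\<in>UNIV. \<integral>x. g x $ i * part_deriv i \<phi> x \<partial>lebesgue)"
      by (intro Bochner_Integration.integral_sum integrable_test_mult locally_integrable_component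
          sq_integrable_imp_locally_integrable g test_part_deriv \<phi>)
    finally show ?thesis ..
  qed
  note gw = weak_grad_W10[OF True]
  have lap: "distr_laplacian (regular_distr w) \<phi> = - (\<integral>x. weak_grad w x \<bullet> grad \<phi> x \<partial>lebesgue)"
    if \<phi>: "\<phi> \<in> test_functions" for \<phi>
  proof -
    have "(\<integral>x. w x * part_deriv i (part_deriv i \<phi>) x \<partial>lebesgue) = - (\<integral>x. weak_grad w x $ i * part_deriv i \<phi> x \<partial>lebesgue)" for i
      using gw(1) test_part_deriv[OF \<phi>] unfolding has_weak_gradient_iff by blast
    then show ?thesis
      by (simp add: distr_laplacian_def distr_deriv_def regular_distr_def sum_negf sum_inner[OF gw(2) \<phi>])
  qed
  have div: "distr_div (\<lambda>i. regular_distr (\<lambda>x. (indicator \<Omega> x *\<^sub>R M x) $ i)) \<phi> =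
      - (\<integral>x. (indicator \<Omega> x *\<^sub>R M x) \<bullet> grad \<phi> x \<partial>lebesgue)" if \<phi>: "\<phi> \<in> test_functions" for \<phi>
    unfolding distr_div_def distr_deriv_def regular_distr_def sum_negf sum_inner[OF F \<phi>] ..
  show ?thesis
    using True lap div by (simp add: distributional_solution_def distr_eq_def)
qed (simp add: distributional_solution_def)

theorem proposition2p1:
  fixes \<Omega> :: "(real^3) set" and M :: "real^3 \<Rightarrow> real^3"
  assumes "open \<Omega>" and "connected \<Omega>" and "lipschitz_boundary \<Omega>"
    and "L2_on \<Omega> M"
  shows "\<exists>u.
    variational_solution \<Omega> M u \<and>
    (\<forall>w. variational_solution \<Omega> M w \<longrightarrow> (AE x in lebesgue. w x = u x)) \<and>
    distributional_solution \<Omega> M u \<and>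
    (\<forall>w. distributional_solution \<Omega> M w \<longrightarrow> (AE x in lebesgue. w x = u x)) \<and>
    L2_norm UNIV (weighted u) \<le> 2 * L2_norm \<Omega> M \<and>
    L2_norm UNIV (weak_grad u) \<le> L2_norm \<Omega> M"
proof -
  \<comment> \<open>Extension by zero turns integrals over \<open>\<Omega>\<close> into integrals
    over the whole space, where the projection takes place.\<close>
  define F where "F x = indicator \<Omega> x *\<^sub>R M x" for x
  have \<Omega>: "\<Omega> \<in> sets lebesgue" using assms(1) by simp
  have F_sq: "(norm (F x))\<^sup>2 = indicator \<Omega> x *\<^sub>R (norm (M x))\<^sup>2" for x
    by (simp add: F_def indicator_def)
  have F: "sq_integrable lebesgue F"
    using assms(4) \<Omega> unfolding L2_on_def sq_integrable_def F_sq
    by (simp add: F_def[abs_def] integrable_restrict_space borel_measurable_restrict_space_iff)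
  have norm_M: "L2_norm \<Omega> M = sqrt (\<integral>x. (norm (F x))\<^sup>2 \<partial>lebesgue)"
    unfolding L2_norm_def F_sq using \<Omega> by (subst integral_restrict_space) auto
  have int_M: "(\<integral>x. M x \<bullet> g x \<partial>lebesgue_on \<Omega>) = (\<integral>x. F x \<bullet> g x \<partial>lebesgue)" for g
    using \<Omega> by (subst integral_restrict_space) (auto simp: F_def)
  obtain u G \<phi> where G: "sq_integrable lebesgue G" and u: "has_weak_gradient u G" "sq_integrable lebesgue (weighted u)"
    and orth: "\<And>\<psi>. \<psi> \<in> test_functions \<Longrightarrow> (\<integral>x. (F x - G x) \<bullet> grad \<psi> x \<partial>lebesgue) = 0"
    and le_G: "(\<integral>x. (norm (G x))\<^sup>2 \<partial>lebesgue) \<le> (\<integral>x. (norm (F x))\<^sup>2 \<partial>lebesgue)"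
    and le_u: "(\<integral>x. (norm (weighted u x))\<^sup>2 \<partial>lebesgue) \<le> 4 * (\<integral>x. (norm (G x))\<^sup>2 \<partial>lebesgue)"
    by (rule gradient_projection[OF F]) (rule that)
  have uW: "u \<in> W10" by (rule W10_I[OF u(2,1) G])
  have Gu: "AE x in lebesgue. weak_grad u x = G x" by (rule weak_grad_AE_eq[OF u(1)])
  have var_u: "variational_solution \<Omega> M u"
    unfolding variational_solution_def
  proof (intro conjI ballI uW)
    fix v assume v: "v \<in> W10"
    note gv = weak_grad_W10(2)[OF v]
    have "(\<integral>x. (F x - G x) \<bullet> weak_grad v x \<partial>lebesgue) = 0"
      by (rule orthogonal_weak_grad[OF sq_integrable_diff[OF F G] orth v])
    then have "(\<integral>x. G x \<bullet> weak_grad v x \<partial>lebesgue) = (\<integral>x. F x \<bullet> weak_grad v x \<partial>lebesgue)"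
      by (simp add: inner_diff_left sq_integrable_inner F G gv)
    then show "(\<integral>x. weak_grad u x \<bullet> weak_grad v x \<partial>lebesgue) = (\<integral>x. M x \<bullet> weak_grad v x \<partial>lebesgue_on \<Omega>)"
      using integral_inner_cong_AE[OF Gu weak_grad_W10(2)[OF uW] G gv] by (simp add: inner_commute int_M)
  qed
  have dist_iff: "distributional_solution \<Omega> M w \<longleftrightarrow> w \<in> W10 \<and> (\<forall>\<phi>\<in>test_functions.
    (\<integral>x. weak_grad w x \<bullet> grad \<phi> x \<partial>lebesgue) = (\<integral>x. F x \<bullet> grad \<phi> x \<partial>lebesgue))" for w
    using distributional_solution_iff F unfolding F_def[abs_def] by blast
  have var_dist: "distributional_solution \<Omega> M w" if w: "variational_solution \<Omega> M w" for w
    unfolding dist_iff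
  proof (intro conjI ballI)
    show wW: "w \<in> W10" using w by (simp add: variational_solution_def)
    fix \<phi> :: "real^3 \<Rightarrow> real" assume \<phi>: "\<phi> \<in> test_functions"
    note sq\<phi> = test_grad_sq_integrable[OF \<phi>] weak_grad_W10(2)[OF test_W10[OF \<phi>]]
    have "(\<integral>x. weak_grad w x \<bullet> weak_grad \<phi> x \<partial>lebesgue) = (\<integral>x. F x \<bullet> weak_grad \<phi> x \<partial>lebesgue)"
      using w test_W10[OF \<phi>] by (simp add: variational_solution_def int_M)
    \<comment> \<open>\<open>weak_grad \<phi>\<close> is a chosen representative that is known to
      agree with \<open>grad \<phi>\<close> only almost everywhere, hence the exchange under the
      integral.\<close>
    moreover have "(\<integral>x. h x \<bullet> weak_grad \<phi> x \<partial>lebesgue) = (\<integral>x. h x \<bullet> grad \<phi> x \<partial>lebesgue)"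
      if "sq_integrable lebesgue h" for h
      by (rule integral_inner_cong_AE[OF weak_grad_AE_eq[OF test_has_weak_gradient[OF \<phi>]] sq\<phi>(2,1) that])
    ultimately show "(\<integral>x. weak_grad w x \<bullet> grad \<phi> x \<partial>lebesgue) = (\<integral>x. F x \<bullet> grad \<phi> x \<partial>lebesgue)"
      using weak_grad_W10(2)[OF wW] F by simp
  qed
  \<comment> \<open>Uniqueness is shown for the weaker notion; variational solutions are covered
    because \<open>var_dist\<close> makes them distributional ones.\<close>
  have unique: "AE x in lebesgue. w x = u x" if "distributional_solution \<Omega> M w" for w
    using that var_dist[OF var_u] unfolding dist_iff by (intro W10_unique) auto
  have "L2_norm UNIV (weighted u) \<le> sqrt (4 * (\<integral>x. (norm (F x))\<^sup>2 \<partial>lebesgue))"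
    unfolding L2_norm_def lebesgue_on_UNIV_eq using le_u le_G by (intro real_sqrt_le_mono) linarith
  then have bound_u: "L2_norm UNIV (weighted u) \<le> 2 * L2_norm \<Omega> M"
    by (simp add: norm_M real_sqrt_mult)
  have "(\<integral>x. (norm (weak_grad u x))\<^sup>2 \<partial>lebesgue) = (\<integral>x. (norm (G x))\<^sup>2 \<partial>lebesgue)"
  proof (rule integral_cong_AE)
    show "AE x in lebesgue. (norm (weak_grad u x))\<^sup>2 = (norm (G x))\<^sup>2" using Gu by eventually_elim simp
  qed (use weak_grad_W10(2)[OF uW] G in \<open>auto simp: sq_integrable_def\<close>)
  then have bound_grad: "L2_norm UNIV (weak_grad u) \<le> L2_norm \<Omega> M"
    unfolding norm_M unfolding L2_norm_def lebesgue_on_UNIV_eq using le_G by simp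
  show ?thesis
    using var_u var_dist unique bound_u bound_grad by blast
qed

end
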